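(* Let $n \ge 2$ and let $w \in \mathfrak{S}_n$ be a fully supported permutation. Then the following are equivalent: (i) there is a forced bottom-perimeter tile for $w$ (necessarily the tile $\{n,w(n)\}$); (ii) $w(n)$ and $n$ do not appear together in a $321$-pattern of $w$; (iii) the first right-to-left maximum of $w$ after $w(n)$ (reading right to left) is $n$.
   Context: Permutations are written in one-line notation $w = w(1)w(2)\cdots w(n)$. A permutation $w \in \mathfrak{S}_n$ is fully supported if $\{w(1),\ldots,w(r)\} \ne \{1,\ldots,r\}$ for all $1 \le r < n$ (equivalently, every simple reflection appears in its reduced decompositions). Elnitsky polygon. For fully supported $w \in \mathfrak{S}_n$, $n \ge 2$, Elnitsky's polygon $X(w)$ is the equilateral $2n$-gon whose sides, read counterclockwise starting at the top vertex, are labeled $1,\ldots,n,w(n),\ldots,w(1)$, such that the first $n$ sides form half of a convex $2n$-gon and sides with the same label are parallel. Concretely: fix unit vectors $v_1,\ldots,v_n$ in the plane with angles $\pi < \theta_1 < \cdots < \theta_n < 2\pi$; with the top vertex at the origin, the leftside boundary is the path with vertices $v_1+\cdots+v_k$ ($0\le k\le n$), its $k$th edge labeled $k$, and the rightside boundary is the path with vertices $v_{w(1)}+\cdots+v_{w(k)}$ ($0 \le k \le n$), its $k$th edge labeled $w(k)$. Both paths end at the bottom vertex, and $X(w)$ is the region they bound. The two edges at the bottom vertex are labeled $n$ and $w(n)$. Tilings. A rhombic tiling of $X(w)$ is an (edge-to-edge) tiling by rhombi whose edges are all congruent and parallel to edges of $X(w)$ (unit rhombi with sides parallel to $v_i$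 and $v_j$, $i \ne j$). $T(w)$ is the set of all rhombic tilings of $X(w)$. The labels of a tile are the labels $\{i,j\}$ of the sides of $X(w)$ to which its edges are parallel. In any tiling no two tiles have the same labels, so a tile is identified with its label set: "the tile $\{x,y\}$". Perimeter tiles. A tile of $T \in T(w)$ is a bottom-perimeter tile if it has as edges the two edges of $X(w)$ on either side of the bottom vertex. The tile $\{x,y\}$ is a forced bottom-perimeter tile for $w$ if in every $T \in T(w)$ the tile $\{x,y\}$ is present and is a bottom-perimeter tile. Patterns. A $321$-pattern in $w$ is a triple of values $w(i)>w(j)>w(l)$ with $i<j<l$; two values appear together in a $321$-pattern if both belong to some such triple. A right-to-left maximum of $w$ is a value $w(i)$ with $w(i) > w(j)$ for all $j>i$ (so $w(n)$ is always one). *)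

theory Defs
  imports "HOL-Analysis.Analysis" "HOL-Combinatorics.Permutations"
begin

text \<open>
  A permutation in the symmetric group on \<open>n\<close> letters is a function \<open>w\<close> with
  \<open>w permutes {1..n}\<close>; its one-line notation is \<open>w 1, \<dots>, w n\<close>.
  The plane is the type of complex numbers, and the unit vector with label \<open>i\<close>
  is \<open>cis (\<theta> i)\<close>.
\<close>

definition fully_supported :: "nat \<Rightarrow> (nat \<Rightarrow> nat) \<Rightarrow> bool" where
  "fully_supported n w \<longleftrightarrow> (\<forall>r. 1 \<le> r \<and> r < n \<longrightarrow> w ` {1..r} \<noteq> {1..r})"

definition admissible_angles :: "nat \<Rightarrow> (nat \<Rightarrow> real) \<Rightarrow> bool" where
  "admissible_angles n \<theta> \<longleftrightarrow>
     strict_mono_on {1..n} \<theta> \<and> (\<forall>i\<in>{1..n}. pi < \<theta> i \<and> \<theta> i < 2 * pi)"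


subsection \<open>Elnitsky's polygon\<close>

text \<open>
  The rightside boundary of the polygon is the path for \<open>w\<close> and the leftside boundary is the
  path for \<open>id\<close>; both start at the top vertex, placed at the origin.
\<close>

definition path_vertex :: "(nat \<Rightarrow> real) \<Rightarrow> (nat \<Rightarrow> nat) \<Rightarrow> nat \<Rightarrow> complex" where
  "path_vertex \<theta> u k = (\<Sum>i = 1..k. cis (\<theta> (u i)))"

definition path_edge :: "(nat \<Rightarrow> real) \<Rightarrow> (nat \<Rightarrow> nat) \<Rightarrow> nat \<Rightarrow> complex set" where
  "path_edge \<theta> u k = closed_segment (path_vertex \<theta> u (k - 1)) (path_vertex \<theta> u k)"

definition elnitsky_boundary :: "(nat \<Rightarrow> real) \<Rightarrow> nat \<Rightarrow> (nat \<Rightarrow> nat) \<Rightarrow> complex set" where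
  "elnitsky_boundary \<theta> n w = (\<Union>k\<in>{1..n}. path_edge \<theta> id k) \<union> (\<Union>k\<in>{1..n}. path_edge \<theta> w k)"

definition elnitsky_polygon :: "(nat \<Rightarrow> real) \<Rightarrow> nat \<Rightarrow> (nat \<Rightarrow> nat) \<Rightarrow> complex set" where
  "elnitsky_polygon \<theta> n w = elnitsky_boundary \<theta> n w \<union> inside (elnitsky_boundary \<theta> n w)"


subsection \<open>Rhombic tilings\<close>

definition rhombus :: "(nat \<Rightarrow> real) \<Rightarrow> complex \<Rightarrow> nat \<Rightarrow> nat \<Rightarrow> complex set" where
  "rhombus \<theta> p i j =
     {p + of_real s * cis (\<theta> i) + of_real t * cis (\<theta> j) | s t. s \<in> {0..1} \<and> t \<in> {0..1}}"

definition has_label_set :: "(nat \<Rightarrow> real) \<Rightarrow> nat \<Rightarrow> complex set \<Rightarrow> nat set \<Rightarrow> bool" where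
  "has_label_set \<theta> n R L \<longleftrightarrow>
     (\<exists>i\<in>{1..n}. \<exists>j\<in>{1..n}. \<exists>p. i \<noteq> j \<and> L = {i, j} \<and> R = rhombus \<theta> p i j)"

text \<open>
  The last condition says that the tiling is edge-to-edge: distinct tiles meet in nothing, in
  a common vertex, or in a common full edge. Being two-dimensional, a tile is not a face of a
  different tile, so this also makes the interiors of the tiles pairwise disjoint.
\<close>

definition rhombic_tilings :: "(nat \<Rightarrow> real) \<Rightarrow> nat \<Rightarrow> (nat \<Rightarrow> nat) \<Rightarrow> complex set set set" where
  "rhombic_tilings \<theta> n w =
     {T. finite T \<and> (\<forall>R\<in>T. \<exists>L. has_label_set \<theta> n R L) \<and> \<Union>T = elnitsky_polygon \<theta> n w \<and>
         pairwise (\<lambda>R S. R \<inter> S face_of R \<and> R \<inter> S face_of S) T}"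

definition bottom_perimeter_tile ::
    "(nat \<Rightarrow> real) \<Rightarrow> nat \<Rightarrow> (nat \<Rightarrow> nat) \<Rightarrow> complex set \<Rightarrow> bool" where
  "bottom_perimeter_tile \<theta> n w R \<longleftrightarrow> path_edge \<theta> id n edge_of R \<and> path_edge \<theta> w n edge_of R"

definition forced_bottom_perimeter_tile ::
    "(nat \<Rightarrow> real) \<Rightarrow> nat \<Rightarrow> (nat \<Rightarrow> nat) \<Rightarrow> nat set \<Rightarrow> bool" where
  "forced_bottom_perimeter_tile \<theta> n w L \<longleftrightarrow>
     (\<forall>T\<in>rhombic_tilings \<theta> n w. \<exists>R\<in>T. has_label_set \<theta> n R L \<and> bottom_perimeter_tile \<theta> n w R)"


subsection \<open>Patterns and right-to-left maxima\<close>

definition together_in_321 :: "nat \<Rightarrow> (nat \<Rightarrow> nat) \<Rightarrow> nat \<Rightarrow> nat \<Rightarrow> bool" where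
  "together_in_321 n w x y \<longleftrightarrow>
     (\<exists>i j l. 1 \<le> i \<and> i < j \<and> j < l \<and> l \<le> n \<and> w i > w j \<and> w j > w l \<and>
        x \<in> {w i, w j, w l} \<and> y \<in> {w i, w j, w l})"

text \<open>The following refers to positions: the right-to-left maximum is the value \<open>w i\<close>.\<close>

definition rl_max_at :: "nat \<Rightarrow> (nat \<Rightarrow> nat) \<Rightarrow> nat \<Rightarrow> bool" where
  "rl_max_at n w i \<longleftrightarrow> i \<in> {1..n} \<and> (\<forall>j. i < j \<and> j \<le> n \<longrightarrow> w i > w j)"

text \<open>
  \<open>m\<close> is the first right-to-left maximum that is met after \<open>w n\<close> when \<open>w\<close> is read from right to
  left.
\<close>

definition first_rl_max_after_last :: "nat \<Rightarrow> (nat \<Rightarrow> nat) \<Rightarrow> nat \<Rightarrow> bool" where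
  "first_rl_max_after_last n w m \<longleftrightarrow>
     (\<exists>k<n. rl_max_at n w k \<and> w k = m \<and> (\<forall>j. k < j \<and> j < n \<longrightarrow> \<not> rl_max_at n w j))"

end

theory Submission
  imports Defs
begin

text \<open>
  A point of the polygon is described by its depth below the top vertex and its horizontal
  coordinate; a path given by a permutation is then the graph of a function \<open>X u\<close> of the depth,
  and the polygon is the region between \<open>X id\<close> and \<open>X w\<close>. Attaching a rhombus to the right boundary
  at a descent turns a tiling for \<open>u\<close> with the two entries exchanged into a tiling for \<open>u\<close>.
  Conversely every tiling arises in this way: following the right boundary downwards from the
  first place where it leaves the left boundary, one finds a tile that contains two consecutive
  boundary edges and so can be removed.

  Removing tiles never moves a value smaller than \<open>n\<close> from the left to the right of \<open>n\<close>. So if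
  no value after \<open>n\<close> exceeds the last value, the first removed tile which involves the last position is
  the tile with labels \<open>w n\<close> and \<open>n\<close>. If some value after \<open>n\<close> exceeds the last value, the
  rightmost such value \<open>b\<close> can be moved next to the last position by exchanges at descents, which
  gives a tiling whose tile at the bottom has the labels \<open>w n\<close> and \<open>b\<close>.
\<close>

subsection \<open>Boundary paths as graphs over the depth\<close>

text \<open>All angles lie between \<open>pi\<close> and \<open>2 * pi\<close>, so every edge
  strictly descends and comparing directions of edges amounts to comparing labels; this turns the
  plane geometry into inequalities between functions of the depth. Several obstacles shape the rest.
  The polygon is given through \<open>inside\<close> of a closed curve and must be identified with
  the region between two graphs; horizontal rays and a frontier argument do this in place of the
  Jordan curve theorem. Removing tiles from a tiling of a fully supported permutation can lead to
  permutations that are not fully supported, whose two boundaries touch. The inductions therefore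
  run over all permutations with the notion \<open>tiling\<close>; full support enters through
  \<open>X_id_less\<close>, on the way back to \<open>rhombic_tilings\<close>, and through
  \<open>w n \<noteq> n\<close>. Finally, attaching a tile edge-to-edge requires that the old tiles
  meet the boundary edges in faces, so constructed tilings carry this extra information.\<close>

definition clip :: "real \<Rightarrow> real \<Rightarrow> real" where
  "clip m t = max 0 (min m t)"

lemma continuous_on_clip [continuous_intros]:
  "continuous_on S f \<Longrightarrow> continuous_on S (\<lambda>x. clip m (f x))"
  unfolding clip_def by (intro continuous_intros)

locale elnitsky =
  fixes n :: nat and \<theta> :: "nat \<Rightarrow> real"
  assumes admissible: "admissible_angles n \<theta>"
begin

definition h :: "nat \<Rightarrow> real" where "h i = - sin (\<theta> i)"

text \<open>Horizontal displacement per unit of depth, that is, the negative cotangent of the angle.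
  Since \<open>h\<close> is the depth gained along a unit edge, \<open>cis (\<theta> i)\<close> has
  the coordinates \<open>c i * h i\<close> and \<open>- h i\<close>.\<close>

definition c :: "nat \<Rightarrow> real" where "c i = - cos (\<theta> i) / sin (\<theta> i)"

definition H :: "(nat \<Rightarrow> nat) \<Rightarrow> nat \<Rightarrow> real" where "H u k = (\<Sum>i = 1..k. h (u i))"

text \<open>Each edge contributes its slope times the part of its height passed at depth
  \<open>t\<close>; \<open>clip\<close> gives 0 above the edge and the full height below it. Written
  as one sum instead of by cases, \<open>X\<close> is visibly continuous, and an exchange of
  adjacent entries affects only two summands.\<close>

definition X :: "(nat \<Rightarrow> nat) \<Rightarrow> real \<Rightarrow> real" where
  "X u t = (\<Sum>k = 1..n. c (u k) * clip (h (u k)) (t - H u (k - 1)))"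

abbreviation P :: "(nat \<Rightarrow> nat) \<Rightarrow> nat \<Rightarrow> complex" where "P \<equiv> path_vertex \<theta>"

definition region :: "(nat \<Rightarrow> nat) \<Rightarrow> complex set" where
  "region u = {z. 0 \<le> - Im z \<and> - Im z \<le> H id n \<and> X id (- Im z) \<le> Re z \<and> Re z \<le> X u (- Im z)}"

lemma sin_neg: "i \<in> {1..n} \<Longrightarrow> sin (\<theta> i) < 0"
  using admissible sin_lt_zero unfolding admissible_angles_def by blast

lemma h_pos: "i \<in> {1..n} \<Longrightarrow> 0 < h i"
  using sin_neg by (simp add: h_def)

text \<open>A difference of two cotangents is \<open>sin (\<theta> j - \<theta> i)\<close> over a
  product of sines; here both sines are negative and the angle difference lies strictly between 0
  and \<open>pi\<close>.\<close>

lemma c_less: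
  assumes "i \<in> {1..n}" "j \<in> {1..n}" "i < j"
  shows "c i < c j"
proof -
  have ij: "\<theta> i < \<theta> j" "pi < \<theta> i" "\<theta> j < 2 * pi"
    using admissible assms unfolding admissible_angles_def strict_mono_on_def by auto
  have "0 < sin (\<theta> j - \<theta> i)"
    using ij by (intro sin_gt_zero) auto
  moreover have "0 < sin (\<theta> i) * sin (\<theta> j)"
    using sin_neg assms by (simp add: mult_neg_neg)
  moreover have "c j - c i = sin (\<theta> j - \<theta> i) / (sin (\<theta> i) * sin (\<theta> j))"
    using sin_neg[OF assms(1)] sin_neg[OF assms(2)]
    by (simp add: c_def sin_diff field_simps)
  ultimately have "0 < c j - c i" by simp
  then show ?thesis by simp
qed

lemma c_less_iff: "i \<in> {1..n} \<Longrightarrow> j \<in> {1..n} \<Longrightarrow> c i < c j \<longleftrightarrow> i < j"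
  using c_less[of i j] c_less[of j i] by (metis less_irrefl nat_neq_iff order_less_asym)

lemma c_eq_iff: "i \<in> {1..n} \<Longrightarrow> j \<in> {1..n} \<Longrightarrow> c i = c j \<longleftrightarrow> i = j"
  using c_less_iff[of i j] c_less_iff[of j i] by (metis less_irrefl nat_neq_iff)

lemma Im_cis_h: "Im (cis (\<theta> i)) = - h i"
  by (simp add: h_def)

lemma Re_cis_h: "i \<in> {1..n} \<Longrightarrow> Re (cis (\<theta> i)) = c i * h i"
  using sin_neg[of i] by (simp add: h_def c_def)

lemma permutes_in: "u permutes {1..n} \<Longrightarrow> 1 \<le> k \<Longrightarrow> k \<le> n \<Longrightarrow> u k \<in> {1..n}"
  by (meson atLeastAtMost_iff permutes_in_image)

lemma H_0 [simp]: "H u 0 = 0"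
  by (simp add: H_def)

lemma H_Suc: "H u (Suc k) = H u k + h (u (Suc k))"
  by (simp add: H_def)

lemma H_step: "1 \<le> k \<Longrightarrow> H u k = H u (k - 1) + h (u k)"
  by (cases k) (auto simp: H_Suc)

lemma H_total: "u permutes {1..n} \<Longrightarrow> H u n = H id n"
  unfolding H_def using sum.permute[of u "{1..n}" h] by (simp add: o_def)

lemma H_mono:
  assumes "u permutes {1..n}" "k \<le> l" "l \<le> n"
  shows "H u k \<le> H u l"
  using assms(2,3)
proof (induction l rule: dec_induct)
  case (step l)
  then show ?case using h_pos[OF permutes_in[OF assms(1), of "Suc l"]] by (simp add: H_Suc)
qed auto

lemma P_0 [simp]: "P u 0 = 0"
  by (simp add: path_vertex_def)

lemma P_Suc: "P u (Suc k) = P u k + cis (\<theta> (u (Suc k)))"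
  by (simp add: path_vertex_def)

lemma P_step: "1 \<le> k \<Longrightarrow> P u k = P u (k - 1) + cis (\<theta> (u k))"
  by (cases k) (auto simp: P_Suc)

lemma Im_P: "Im (P u k) = - H u k"
  by (induction k) (auto simp: P_Suc H_Suc Im_cis_h simp del: cis.sel)

lemma P_total: "u permutes {1..n} \<Longrightarrow> P u n = P id n"
  unfolding path_vertex_def using sum.permute[of u "{1..n}" "\<lambda>i. cis (\<theta> i)"] by (simp add: o_def)

lemma Re_P:
  assumes "u permutes {1..n}" "k \<le> n"
  shows "Re (P u k) = (\<Sum>i = 1..k. c (u i) * h (u i))"
  unfolding path_vertex_def Re_sum
  using assms permutes_in Re_cis_h by (intro sum.cong) (auto simp del: cis.sel)

text \<open>Inside edge \<open>k\<close> all earlier edges are passed completely and all later ones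
  not at all. The weights \<open>f\<close> are arbitrary because the slopes give \<open>X\<close>,
  while the constant weight 1 recovers the depth itself.\<close>

lemma sum_clip_on_edge:
  fixes f :: "nat \<Rightarrow> real"
  assumes u: "u permutes {1..n}" and k: "1 \<le> k" "k \<le> n" and s: "0 \<le> s" "s \<le> h (u k)"
  shows "(\<Sum>i = 1..n. f i * clip (h (u i)) (H u (k - 1) + s - H u (i - 1)))
    = (\<Sum>i = 1..k - 1. f i * h (u i)) + f k * s"
proof -
  have before: "clip (h (u i)) (H u (k - 1) + s - H u (i - 1)) = h (u i)" if "i \<in> {1..k - 1}" for i
  proof -
    have "H u i \<le> H u (k - 1)" "H u i = H u (i - 1) + h (u i)"
      using H_mono[OF u, of i "k - 1"] H_step[of i] that k by auto
    then show ?thesis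
      using h_pos[OF permutes_in[OF u, of i]] that k s by (auto simp: clip_def)
  qed
  have after: "clip (h (u i)) (H u (k - 1) + s - H u (i - 1)) = 0" if "i \<in> {k + 1..n}" for i
  proof -
    have "H u k \<le> H u (i - 1)" "H u k = H u (k - 1) + h (u k)"
      using H_mono[OF u, of k "i - 1"] H_step[of k] that k by auto
    then show ?thesis
      using h_pos[OF permutes_in[OF u, of i]] that k s by (auto simp: clip_def)
  qed
  have "{1..n} = {1..k - 1} \<union> {k} \<union> {k + 1..n}" using k by auto
  then have "(\<Sum>i = 1..n. f i * clip (h (u i)) (H u (k - 1) + s - H u (i - 1))) =
     (\<Sum>i \<in> {1..k - 1}. f i * clip (h (u i)) (H u (k - 1) + s - H u (i - 1)))
     + f k * clip (h (u k)) s
     + (\<Sum>i \<in> {k + 1..n}. f i * clip (h (u i)) (H u (k - 1) + s - H u (i - 1)))"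
    using k by (simp only:) (subst sum.union_disjoint; auto)+
  also have "\<dots> = (\<Sum>i = 1..k - 1. f i * h (u i)) + f k * s"
    using before after s by (simp add: clip_def)
  finally show ?thesis .
qed

lemma X_on_edge:
  assumes "u permutes {1..n}" "1 \<le> k" "k \<le> n" "0 \<le> s" "s \<le> h (u k)"
  shows "X u (H u (k - 1) + s) = Re (P u (k - 1)) + c (u k) * s"
  unfolding X_def using sum_clip_on_edge[OF assms, of "\<lambda>i. c (u i)"] Re_P[OF assms(1), of "k - 1"]
    assms(3) by simp

lemma X_at_vertex:
  assumes "u permutes {1..n}" "k \<le> n" "1 \<le> n"
  shows "X u (H u k) = Re (P u k)"
proof (cases "k = n")
  case False
  then show ?thesis
    using X_on_edge[OF assms(1), of "Suc k" 0] h_pos[OF permutes_in[OF assms(1), of "Suc k"]] assms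
    by auto
next
  case True
  then show ?thesis
    using X_on_edge[OF assms(1), of k "h (u k)"] h_pos[OF permutes_in[OF assms(1), of k]] assms
      H_step[of k u] P_step[of k u] permutes_in[OF assms(1), of k]
    by (simp add: Re_cis_h del: cis.sel)
qed

lemma continuous_on_X [continuous_intros]:
  "continuous_on S f \<Longrightarrow> continuous_on S (\<lambda>x. X u (f x))"
  unfolding X_def by (intro continuous_intros)

text \<open>Above the bottom, a depth is assigned to the edge that begins at or above it and ends
  strictly below it. This strictness lets \<open>X_id_less\<close> treat the current label as not
  yet used up.\<close>

lemma obtain_edge:
  assumes "u permutes {1..n}" "1 \<le> n" "0 \<le> t" "t \<le> H id n"
  obtains k s where "1 \<le> k" "k \<le> n" "0 \<le> s" "s \<le> h (u k)" "t = H u (k - 1) + s"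
    "t < H id n \<Longrightarrow> s < h (u k)"
proof -
  have ind: "\<exists>k s. 1 \<le> k \<and> k \<le> m \<and> 0 \<le> s \<and> s < h (u k) \<and> t = H u (k - 1) + s"
    if "t < H u m" "m \<le> n" for m
    using that
  proof (induction m)
    case (Suc m)
    show ?case
    proof (cases "t < H u m")
      case True
      then show ?thesis using Suc by (meson Suc_leD le_Suc_eq)
    next
      case False
      then show ?thesis using Suc(2)
        by (intro exI[of _ "Suc m"] exI[of _ "t - H u m"]) (auto simp: H_Suc)
    qed
  qed (use assms in auto)
  show ?thesis
  proof (cases "t < H id n")
    case True
    then show ?thesis using ind[of n] H_total[OF assms(1)] that by force
  next
    case False
    then have "t = H u (n - 1) + h (u n)"
      using assms H_total[OF assms(1)] H_step[of n u] by auto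
    then show ?thesis
      using that[of n "h (u n)"] assms False h_pos[OF permutes_in[OF assms(1), of n]] by auto
  qed
qed

section \<open>A rhombus as the region between two paths of two edges\<close>

definition G :: "nat \<Rightarrow> nat \<Rightarrow> real \<Rightarrow> real" where
  "G i j s = c i * clip (h i) s + c j * clip (h j) (s - h i)"

lemma continuous_on_G [continuous_intros]:
  "continuous_on S f \<Longrightarrow> continuous_on S (\<lambda>x. G i j (f x))"
  unfolding G_def by (intro continuous_intros)

text \<open>\<open>G i j\<close> is the path that takes edge \<open>i\<close> before edge
  \<open>j\<close>. In either order the two edges have covered the same total height; eliminating
  one of the four clipped heights by this identity leaves a multiple of
  \<open>c j - c i\<close>.\<close>

lemma G_diff:
  assumes "i \<in> {1..n}" "j \<in> {1..n}"
  shows "G j i s - G i j s = (c j - c i) * (clip (h j) s - clip (h j) (s - h i))"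
proof -
  have "clip (h i) s + clip (h j) (s - h i) = clip (h j) s + clip (h i) (s - h j)"
    using h_pos assms[THEN h_pos] by (auto simp: clip_def)
  then have e: "clip (h i) (s - h j) = clip (h i) s + clip (h j) (s - h i) - clip (h j) s" by simp
  show ?thesis unfolding G_def e by (simp add: algebra_simps)
qed

lemma G_le:
  assumes "i \<in> {1..n}" "j \<in> {1..n}" "i < j"
  shows "G i j s \<le> G j i s"
proof -
  have "0 \<le> (c j - c i) * (clip (h j) s - clip (h j) (s - h i))"
    using c_less[OF assms] h_pos[OF assms(1)] by (intro mult_nonneg_nonneg) (auto simp: clip_def)
  then show ?thesis using G_diff[OF assms(1,2), of s] by simp
qed

lemma G_less:
  assumes "i \<in> {1..n}" "j \<in> {1..n}" "i < j" "0 < s" "s < h i + h j"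
  shows "G i j s < G j i s"
proof -
  have "0 < (c j - c i) * (clip (h j) s - clip (h j) (s - h i))"
    using c_less[OF assms(1-3)] h_pos[OF assms(1)] h_pos[OF assms(2)] assms(4,5)
    by (intro mult_pos_pos) (auto simp: clip_def)
  then show ?thesis using G_diff[OF assms(1,2), of s] by simp
qed

lemma G_eq_outside:
  assumes "i \<in> {1..n}" "j \<in> {1..n}" "s \<le> 0 \<or> h i + h j \<le> s"
  shows "G i j s = G j i s"
  using G_diff[OF assms(1,2), of s] h_pos[OF assms(1)] h_pos[OF assms(2)] assms(3)
  by (auto simp: clip_def)

text \<open>At depth \<open>\<sigma>\<close> a point splits its depth as \<open>a + b\<close>
  between the two directions and has the offset \<open>c i * \<sigma> + (c j - c i) * b\<close>. The
  bounds on \<open>a\<close> and \<open>b\<close> say that \<open>b\<close> lies between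
  \<open>max 0 (\<sigma> - h i)\<close> and \<open>min \<sigma> (h j)\<close>; the two ends give the
  left path \<open>G i j\<close> and the right path \<open>G j i\<close>.\<close>

lemma mem_rhombus_iff:
  assumes i: "i \<in> {1..n}" and j: "j \<in> {1..n}" and "i < j"
  shows "z \<in> rhombus \<theta> p i j \<longleftrightarrow>
    0 \<le> Im p - Im z \<and> Im p - Im z \<le> h i + h j \<and>
    G i j (Im p - Im z) \<le> Re z - Re p \<and> Re z - Re p \<le> G j i (Im p - Im z)"
    (is "?A \<longleftrightarrow> ?B")
proof -
  note hi = h_pos[OF i] and hj = h_pos[OF j] and cc = c_less[OF assms]
  define \<sigma> where "\<sigma> = Im p - Im z"
  define x where "x = Re z - Re p"
  have "?A \<longleftrightarrow> (\<exists>s\<in>{0..1}. \<exists>t\<in>{0..1}. x = s * (c i * h i) + t * (c j * h j) \<and> \<sigma> = s * h i + t * h j)"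
  proof -
    have "z = p + of_real s * cis (\<theta> i) + of_real t * cis (\<theta> j) \<longleftrightarrow>
        x = s * (c i * h i) + t * (c j * h j) \<and> \<sigma> = s * h i + t * h j" for s t
      unfolding x_def \<sigma>_def complex_eq_iff
      by (auto simp: Re_cis_h[OF i] Re_cis_h[OF j] Im_cis_h simp del: cis.sel)
    then show ?thesis unfolding rhombus_def mem_Collect_eq by blast
  qed
  also have "\<dots> \<longleftrightarrow> (\<exists>a\<in>{0..h i}. \<exists>b\<in>{0..h j}. x = c i * a + c j * b \<and> \<sigma> = a + b)"
  proof safe
    fix s t :: real assume "s \<in> {0..1}" "t \<in> {0..1}"
    then show "\<exists>a\<in>{0..h i}. \<exists>b\<in>{0..h j}. s * (c i * h i) + t * (c j * h j) = c i * a + c j * b \<and>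
        s * h i + t * h j = a + b"
      using hi hj by (intro bexI[of _ "s * h i"] bexI[of _ "t * h j"]) (auto simp: mult_left_le_one_le)
  next
    fix a b :: real assume "a \<in> {0..h i}" "b \<in> {0..h j}"
    then show "\<exists>s\<in>{0..1}. \<exists>t\<in>{0..1}. c i * a + c j * b = s * (c i * h i) + t * (c j * h j) \<and>
        a + b = s * h i + t * h j"
      using hi hj by (intro bexI[of _ "a / h i"] bexI[of _ "b / h j"]) auto
  qed
  also have "\<dots> \<longleftrightarrow> 0 \<le> \<sigma> \<and> \<sigma> \<le> h i + h j \<and> G i j \<sigma> \<le> x \<and> x \<le> G j i \<sigma>"
  proof safe
    fix a b :: real assume ab: "a \<in> {0..h i}" "b \<in> {0..h j}"
    show "0 \<le> a + b" "a + b \<le> h i + h j" using ab by auto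
    have e: "G i j (a + b) = c i * (a + b) + (c j - c i) * max 0 (a + b - h i)"
      "G j i (a + b) = c j * (a + b) + (c i - c j) * max 0 (a + b - h j)"
    proof -
      have "clip (h i) (a + b) = a + b - max 0 (a + b - h i)"
        "clip (h j) (a + b) = a + b - max 0 (a + b - h j)"
        "clip (h j) (a + b - h i) = max 0 (a + b - h i)"
        "clip (h i) (a + b - h j) = max 0 (a + b - h j)"
        using ab hi hj by (auto simp: clip_def)
      note clips = this
      show "G i j (a + b) = c i * (a + b) + (c j - c i) * max 0 (a + b - h i)"
        "G j i (a + b) = c j * (a + b) + (c i - c j) * max 0 (a + b - h j)"
        unfolding G_def clips by (simp_all add: algebra_simps)
    qed
    have "(c j - c i) * max 0 (a + b - h i) \<le> (c j - c i) * b"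
      "(c j - c i) * max 0 (a + b - h j) \<le> (c j - c i) * a"
      using ab cc by (intro mult_left_mono; simp)+
    then show "G i j (a + b) \<le> c i * a + c j * b" "c i * a + c j * b \<le> G j i (a + b)"
      unfolding e by (simp_all add: algebra_simps)
  next
    assume \<sigma>: "0 \<le> \<sigma>" "\<sigma> \<le> h i + h j" and x: "G i j \<sigma> \<le> x" "x \<le> G j i \<sigma>"
    have e: "G i j \<sigma> = c i * \<sigma> + (c j - c i) * max 0 (\<sigma> - h i)"
      "G j i \<sigma> = c i * \<sigma> + (c j - c i) * min \<sigma> (h j)"
    proof -
      have "clip (h i) \<sigma> = \<sigma> - max 0 (\<sigma> - h i)" "clip (h j) \<sigma> = min \<sigma> (h j)"
        "clip (h j) (\<sigma> - h i) = max 0 (\<sigma> - h i)" "clip (h i) (\<sigma> - h j) = \<sigma> - min \<sigma> (h j)"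
        using \<sigma> hi hj by (auto simp: clip_def)
      note clips = this
      show "G i j \<sigma> = c i * \<sigma> + (c j - c i) * max 0 (\<sigma> - h i)"
        "G j i \<sigma> = c i * \<sigma> + (c j - c i) * min \<sigma> (h j)"
        unfolding G_def clips by (simp_all add: algebra_simps)
    qed
    define b where "b = (x - c i * \<sigma>) / (c j - c i)"
    have x': "x - c i * \<sigma> = (c j - c i) * b" using cc by (simp add: b_def)
    have "(c j - c i) * max 0 (\<sigma> - h i) \<le> (c j - c i) * b"
      "(c j - c i) * b \<le> (c j - c i) * min \<sigma> (h j)"
      using x unfolding e x'[symmetric] by linarith+
    then have "max 0 (\<sigma> - h i) \<le> b" "b \<le> min \<sigma> (h j)"
      using cc by (auto dest: mult_left_le_imp_le)
    then show "\<exists>a\<in>{0..h i}. \<exists>b\<in>{0..h j}. x = c i * a + c j * b \<and> \<sigma> = a + b"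
      using x' by (intro bexI[of _ "\<sigma> - b"] bexI[of _ b]) (auto simp: algebra_simps)
  qed
  finally show ?thesis unfolding x_def \<sigma>_def .
qed

subsection \<open>Exchanging adjacent entries\<close>

abbreviation swap :: "(nat \<Rightarrow> nat) \<Rightarrow> nat \<Rightarrow> nat \<Rightarrow> nat" where
  "swap u k \<equiv> u \<circ> Transposition.transpose k (Suc k)"

lemma swap_permutes:
  "u permutes {1..n} \<Longrightarrow> 1 \<le> k \<Longrightarrow> k < n \<Longrightarrow> swap u k permutes {1..n}"
  by (intro permutes_compose permutes_swap_id) auto

text \<open>The transposition maps \<open>{1..m}\<close> to itself unless \<open>m = k\<close>.
  Hence an exchange moves only the boundary vertex with index \<open>k\<close>.\<close>

lemma sum_swap:
  fixes f :: "nat \<Rightarrow> 'b::comm_monoid_add"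
  assumes "1 \<le> k" "m \<noteq> k"
  shows "(\<Sum>i = 1..m. f (swap u k i)) = (\<Sum>i = 1..m. f (u i))"
proof (cases "m < k")
  case True
  then show ?thesis by (intro sum.cong) auto
next
  case False
  then have "Transposition.transpose k (Suc k) permutes {1..m}"
    using assms by (intro permutes_swap_id) auto
  from sum.permute[OF this, of "\<lambda>i. f (u i)"] show ?thesis by (simp add: o_def)
qed

lemma H_swap: "1 \<le> k \<Longrightarrow> m \<noteq> k \<Longrightarrow> H (swap u k) m = H u m"
  unfolding H_def by (rule sum_swap)

lemma P_swap: "1 \<le> k \<Longrightarrow> m \<noteq> k \<Longrightarrow> P (swap u k) m = P u m"
  unfolding path_vertex_def by (rule sum_swap)

text \<open>Edge \<open>k + 1\<close> starts where edge \<open>k\<close> ends, so their two summands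
  combine to one value of \<open>G\<close>, counted from the depth of vertex \<open>k - 1\<close>;
  the other summands are unchanged.\<close>

lemma X_swap:
  assumes "1 \<le> k" "k < n"
  shows "X u t - X (swap u k) t =
    G (u k) (u (Suc k)) (t - H u (k - 1)) - G (u (Suc k)) (u k) (t - H u (k - 1))"
proof -
  have split: "X v t = (\<Sum>i\<in>{1..n} - {k, Suc k}. c (v i) * clip (h (v i)) (t - H v (i - 1)))
      + G (v k) (v (Suc k)) (t - H v (k - 1))" for v
    unfolding X_def G_def using assms H_step[of k v]
    by (subst sum.subset_diff[of "{k, Suc k}"]) (auto simp: algebra_simps)
  have "(\<Sum>i\<in>{1..n} - {k, Suc k}. c (swap u k i) * clip (h (swap u k i)) (t - H (swap u k) (i - 1)))
    = (\<Sum>i\<in>{1..n} - {k, Suc k}. c (u i) * clip (h (u i)) (t - H u (i - 1)))"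
    using H_swap[OF assms(1)] by (intro sum.cong) auto
  moreover have "H (swap u k) (k - 1) = H u (k - 1)"
    using assms by (intro H_swap) auto
  ultimately show ?thesis
    unfolding split[of u] split[of "swap u k"] by simp
qed

lemma X_two_edges:
  assumes u: "u permutes {1..n}" and k: "1 \<le> k" "k < n"
    and s: "0 \<le> s" "s \<le> h (u k) + h (u (Suc k))"
  shows "X u (H u (k - 1) + s) = Re (P u (k - 1)) + G (u k) (u (Suc k)) s"
proof -
  have hk: "0 < h (u k)" "0 < h (u (Suc k))" using h_pos permutes_in[OF u] k by auto
  show ?thesis
  proof (cases "s \<le> h (u k)")
    case True
    then show ?thesis using X_on_edge[OF u, of k s] k s hk by (simp add: G_def clip_def)
  next
    case False
    have "Re (P u k) = Re (P u (k - 1)) + c (u k) * h (u k)"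
      using P_step[of k u] Re_cis_h permutes_in[OF u] k by (simp del: cis.sel)
    then show ?thesis using X_on_edge[OF u, of "Suc k" "s - h (u k)"] False k s hk H_step[of k u]
      by (simp add: G_def clip_def)
  qed
qed

text \<open>Over the two edges both graphs are paths of the form \<open>G\<close> from the same
  vertex, so \<open>mem_rhombus_iff\<close> applies. This makes attaching and removing tiles
  correspond to exchanges at descents.\<close>

lemma mem_corner_rhombus_iff:
  assumes u: "u permutes {1..n}" and k: "1 \<le> k" "k < n" and desc: "u (Suc k) < u k"
  shows "z \<in> rhombus \<theta> (P u (k - 1)) (u (Suc k)) (u k) \<longleftrightarrow>
    H u (k - 1) \<le> - Im z \<and> - Im z \<le> H u (Suc k) \<and>
    X (swap u k) (- Im z) \<le> Re z \<and> Re z \<le> X u (- Im z)"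
proof -
  define s where "s = - Im z - H u (k - 1)"
  have H2: "H u (Suc k) = H u (k - 1) + (h (u k) + h (u (Suc k)))"
    using H_step[of k u] k by (simp add: H_Suc)
  have "X u (- Im z) = Re (P u (k - 1)) + G (u k) (u (Suc k)) s"
    "X (swap u k) (- Im z) = Re (P u (k - 1)) + G (u (Suc k)) (u k) s"
    if "0 \<le> s" "s \<le> h (u k) + h (u (Suc k))"
    using X_two_edges[OF u k, of s] X_two_edges[OF swap_permutes[OF u k] k, of s] that
      H_swap[OF k(1), of "k - 1" u] P_swap[OF k(1), of "k - 1" u] k
    by (auto simp: s_def algebra_simps)
  note heights = this
  have lab: "u (Suc k) \<in> {1..n}" "u k \<in> {1..n}" using permutes_in[OF u] k by auto
  have Ims: "Im (P u (k - 1)) - Im z = s" by (simp add: s_def Im_P)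
  have range: "0 \<le> s \<and> s \<le> h (u (Suc k)) + h (u k) \<longleftrightarrow> H u (k - 1) \<le> - Im z \<and> - Im z \<le> H u (Suc k)"
    unfolding H2 s_def by auto
  show ?thesis
    unfolding mem_rhombus_iff[OF lab desc] Ims range[symmetric]
  proof (cases "0 \<le> s \<and> s \<le> h (u (Suc k)) + h (u k)")
    case True
    then show "(0 \<le> s \<and> s \<le> h (u (Suc k)) + h (u k) \<and>
        G (u (Suc k)) (u k) s \<le> Re z - Re (P u (k - 1)) \<and>
        Re z - Re (P u (k - 1)) \<le> G (u k) (u (Suc k)) s) =
      (H u (k - 1) \<le> - Im z \<and> - Im z \<le> H u (Suc k) \<and>
        X (swap u k) (- Im z) \<le> Re z \<and> Re z \<le> X u (- Im z))"
      using heights range by auto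
  next
    case False
    then show "(0 \<le> s \<and> s \<le> h (u (Suc k)) + h (u k) \<and>
        G (u (Suc k)) (u k) s \<le> Re z - Re (P u (k - 1)) \<and>
        Re z - Re (P u (k - 1)) \<le> G (u k) (u (Suc k)) s) =
      (H u (k - 1) \<le> - Im z \<and> - Im z \<le> H u (Suc k) \<and>
        X (swap u k) (- Im z) \<le> Re z \<and> Re z \<le> X u (- Im z))"
      using range by blast
  qed
qed

lemma X_swap_le:
  assumes u: "u permutes {1..n}" "1 \<le> k" "k < n" "u (Suc k) < u k"
  shows "X (swap u k) t \<le> X u t"
proof -
  have "u (Suc k) \<in> {1..n}" "u k \<in> {1..n}" using permutes_in[OF u(1)] u(2,3) by auto
  then show ?thesis using X_swap[OF u(2,3), of u t] G_le u(4) by (metis diff_ge_0_iff_ge)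
qed

lemma X_swap_less:
  assumes u: "u permutes {1..n}" "1 \<le> k" "k < n" "u (Suc k) < u k"
    and t: "H u (k - 1) < t" "t < H u (Suc k)"
  shows "X (swap u k) t < X u t"
proof -
  have "u (Suc k) \<in> {1..n}" "u k \<in> {1..n}" using permutes_in[OF u(1)] u(2,3) by auto
  then have "G (u (Suc k)) (u k) (t - H u (k - 1)) < G (u k) (u (Suc k)) (t - H u (k - 1))"
    using t u(4) H_step[OF u(2), of u] H_Suc[of u k] by (intro G_less) auto
  then show ?thesis using X_swap[OF u(2,3), of u t] by simp
qed

lemma X_swap_eq:
  assumes u: "u permutes {1..n}" "1 \<le> k" "k < n"
    and t: "t \<le> H u (k - 1) \<or> H u (Suc k) \<le> t"
  shows "X (swap u k) t = X u t"
proof -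
  have "u (Suc k) \<in> {1..n}" "u k \<in> {1..n}" using permutes_in[OF u(1)] u(2,3) by auto
  then have "G (u (Suc k)) (u k) (t - H u (k - 1)) = G (u k) (u (Suc k)) (t - H u (k - 1))"
    using t H_step[OF u(2), of u] H_Suc[of u k] by (intro G_eq_outside) auto
  then show ?thesis using X_swap[OF u(2,3), of u t] by simp
qed

subsection \<open>The left boundary\<close>

text \<open>Indexed by labels instead of positions, so that the paths of two permutations can be
  compared summand by summand; \<open>inv u i\<close> is the position of label
  \<open>i\<close>.\<close>

definition fill :: "(nat \<Rightarrow> nat) \<Rightarrow> real \<Rightarrow> nat \<Rightarrow> real" where
  "fill u t i = clip (h i) (t - H u (inv u i - 1))"

lemma sum_fill:
  assumes u: "u permutes {1..n}"
  shows "(\<Sum>i = 1..n. f i * fill u t i) =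
    (\<Sum>k = 1..n. f (u k) * clip (h (u k)) (t - H u (k - 1)))"
  using sum.permute[OF u, of "\<lambda>i. f i * fill u t i"] permutes_inverses(2)[OF u]
  by (simp add: o_def fill_def)

lemma X_eq_sum_fill: "u permutes {1..n} \<Longrightarrow> X u t = (\<Sum>i = 1..n. c i * fill u t i)"
  unfolding X_def by (rule sum_fill[symmetric])

lemma sum_fill_total:
  assumes u: "u permutes {1..n}" "1 \<le> n" "0 \<le> t" "t \<le> H id n"
  shows "(\<Sum>i = 1..n. fill u t i) = t"
proof -
  obtain k s where k: "1 \<le> k" "k \<le> n" "0 \<le> s" "s \<le> h (u k)" "t = H u (k - 1) + s"
    using obtain_edge[OF assms] .
  show ?thesis
    using sum_fill[OF u(1), of "\<lambda>_. 1" t] sum_clip_on_edge[OF u(1) k(1-4), of "\<lambda>_. 1"] k(5)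
    by (simp add: H_def)
qed

lemma fill_bounds: "i \<in> {1..n} \<Longrightarrow> 0 \<le> fill u t i \<and> fill u t i \<le> h i"
  using h_pos[of i] by (auto simp: fill_def clip_def)

lemma fill_id:
  assumes "1 \<le> q" "q \<le> n" "H id (q - 1) \<le> t" "t \<le> H id q" "i \<in> {1..n}"
  shows "i < q \<Longrightarrow> fill id t i = h i" "q < i \<Longrightarrow> fill id t i = 0"
proof -
  have id: "id permutes {1..n}" by (rule permutes_id)
  assume "i < q"
  then have "H id i \<le> H id (q - 1)" using assms by (intro H_mono[OF id]) auto
  then show "fill id t i = h i"
    using H_step[of i id] h_pos[OF assms(5)] assms by (auto simp: fill_def clip_def)
next
  have id: "id permutes {1..n}" by (rule permutes_id)
  assume "q < i"
  then have "H id q \<le> H id (i - 1)" using assms by (intro H_mono[OF id]) auto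
  then show "fill id t i = 0"
    using assms by (auto simp: fill_def clip_def)
qed

text \<open>\<open>X id t\<close> is the optimum of a fractional knapsack problem: the labels with the smallest
  \<open>c\<close> are used up first. Comparing with the label \<open>q\<close> at which the greedy solution stops makes
  every summand nonnegative.\<close>

lemma knapsack:
  assumes u: "u permutes {1..n}" and q: "1 \<le> q" "q \<le> n" "H id (q - 1) \<le> t" "t \<le> H id q"
  shows "X u t - X id t = (\<Sum>i = 1..n. (c i - c q) * (fill u t i - fill id t i))"
    and "i \<in> {1..n} \<Longrightarrow> 0 \<le> (c i - c q) * (fill u t i - fill id t i)"
proof -
  have id: "id permutes {1..n}" by (rule permutes_id)
  have "0 \<le> H id (q - 1)" using H_mono[OF id, of 0 "q - 1"] q by auto
  moreover have "H id q \<le> H id n" using H_mono[OF id, of q n] q by auto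
  ultimately have t: "1 \<le> n" "0 \<le> t" "t \<le> H id n" using q by auto
  \<comment> \<open>Both fillings sum to \<open>t\<close>, so shifting all slopes by the constant
    \<open>c q\<close> does not change the difference.\<close>
  have "c q * (\<Sum>i = 1..n. fill u t i - fill id t i) = 0"
    using sum_fill_total[OF u t] sum_fill_total[OF id t] by (simp add: sum_subtractf)
  then show "X u t - X id t = (\<Sum>i = 1..n. (c i - c q) * (fill u t i - fill id t i))"
    unfolding X_eq_sum_fill[OF u] X_eq_sum_fill[OF id]
    by (simp add: sum_subtractf sum_distrib_left algebra_simps sum.distrib)
next
  assume i: "i \<in> {1..n}"
  consider "i < q" | "i = q" | "q < i" by linarith
  then show "0 \<le> (c i - c q) * (fill u t i - fill id t i)"
  proof cases
    case 1
    then show ?thesis using fill_id(1)[OF q i] fill_bounds[OF i, of u t] c_less[of i q] i q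
      by (intro mult_nonpos_nonpos) auto
  next
    case 3
    then show ?thesis using fill_id(2)[OF q i] fill_bounds[OF i, of u t] c_less[of q i] i q
      by (intro mult_nonneg_nonneg) auto
  qed simp
qed

lemma X_id_le:
  assumes u: "u permutes {1..n}" "1 \<le> n" "0 \<le> t" "t \<le> H id n"
  shows "X id t \<le> X u t"
proof -
  have id: "id permutes {1..n}" by (rule permutes_id)
  obtain q s where q: "1 \<le> q" "q \<le> n" "0 \<le> s" "s \<le> h (id q)" "t = H id (q - 1) + s"
    using obtain_edge[OF id assms(2-4)] .
  have q': "H id (q - 1) \<le> t" "t \<le> H id q" using q H_step[of q id] by auto
  have "0 \<le> X u t - X id t"
    unfolding knapsack(1)[OF u(1) q(1,2) q']
    by (intro sum_nonneg knapsack(2)[OF u(1) q(1,2) q'])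
  then show ?thesis by simp
qed

text \<open>Equality would make every summand of \<open>knapsack\<close> vanish, so at depth
  \<open>t\<close> the path of \<open>u\<close> would have used the same amount of each label as the
  left boundary. Then, for a suitable \<open>r < n\<close>, no label above \<open>r\<close> precedes
  a label up to \<open>r\<close>, and \<open>u\<close> maps \<open>{1..r}\<close> to itself, against
  full support.\<close>

lemma X_id_less:
  assumes u: "u permutes {1..n}" and fs: "fully_supported n u" and n: "2 \<le> n"
    and t: "0 < t" "t < H id n"
  shows "X id t < X u t"
proof (rule ccontr)
  assume "\<not> X id t < X u t"
  then have eq: "X u t - X id t = 0" using X_id_le[OF u, of t] n t by auto
  have id: "id permutes {1..n}" by (rule permutes_id)
  obtain q s where q: "1 \<le> q" "q \<le> n" "0 \<le> s" "s \<le> h (id q)" "t = H id (q - 1) + s"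
    "t < H id n \<Longrightarrow> s < h (id q)"
    using obtain_edge[OF id] n t by (smt (verit) one_le_numeral order_trans)
  have q': "H id (q - 1) \<le> t" "t \<le> H id q" using q H_step[of q id] by auto
  have "\<forall>i\<in>{1..n}. (c i - c q) * (fill u t i - fill id t i) = 0"
    using eq unfolding knapsack(1)[OF u q(1,2) q']
    by (subst (asm) sum_nonneg_eq_0_iff) (auto intro: knapsack(2)[OF u q(1,2) q'])
  then have off: "fill u t i = fill id t i" if "i \<in> {1..n}" "i \<noteq> q" for i
    using that c_eq_iff[of i q] q by auto
  have "fill u t q = fill id t q"
  proof -
    have "(\<Sum>i = 1..n. fill v t i) = fill v t q + (\<Sum>i\<in>{1..n} - {q}. fill v t i)" for v
      using q by (intro sum.remove) auto
    moreover have "(\<Sum>i\<in>{1..n} - {q}. fill u t i) = (\<Sum>i\<in>{1..n} - {q}. fill id t i)"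
      using off by (intro sum.cong) auto
    moreover have "(\<Sum>i = 1..n. fill u t i) = t" "(\<Sum>i = 1..n. fill id t i) = t"
      using sum_fill_total[OF u, of t] sum_fill_total[OF id, of t] n t by auto
    ultimately show ?thesis by (metis add_right_cancel)
  qed
  then have fq: "fill u t q = s"
    using q t by (simp add: fill_def clip_def)
  \<comment> \<open>The cut must separate labels already begun from labels not finished. Label
    \<open>q\<close>, at which the greedy filling stops, is not finished, so \<open>q - 1\<close>
    serves. Only for \<open>q = 1\<close> would this be 0; then label 1 itself is begun because
    \<open>t\<close> is positive.\<close>
  define r where "r = (if q = 1 then 1 else q - 1)"
  have r: "1 \<le> r" "r < n" "r \<le> q" "q \<le> Suc r" using q n by (auto simp: r_def)
  have early: "0 < fill u t i" if "i \<in> {1..r}" for i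
  proof (cases "i = q")
    case True
    then have "q = 1" using that r q by (auto simp: r_def split: if_splits)
    then show ?thesis using fq q t True by simp
  next
    case False
    then have "i < q" "i \<in> {1..n}" using that r by auto
    then show ?thesis using off fill_id(1)[OF q(1,2) q'] h_pos by auto
  qed
  have late: "fill u t i < h i" if "i \<in> {r + 1..n}" for i
  proof (cases "i = q")
    case True
    then show ?thesis using fq q t by auto
  next
    case False
    then have "q < i" "i \<in> {1..n}" using that r by auto
    then show ?thesis using off fill_id(2)[OF q(1,2) q'] h_pos by auto
  qed
  \<comment> \<open>Once the edge of a label is begun, the edges at all earlier positions are
    finished.\<close>
  have order: "\<not> (k < k' \<and> r < u k \<and> u k' \<le> r)" if k: "k \<in> {1..n}" "k' \<in> {1..n}" for k k'
  proof
    assume *: "k < k' \<and> r < u k \<and> u k' \<le> r"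
    have uk: "u k \<in> {1..n}" "u k' \<in> {1..n}" using k permutes_in[OF u] by auto
    have "0 < fill u t (u k')" using early[of "u k'"] * uk by auto
    then have "H u (k' - 1) < t"
      using permutes_inverses(2)[OF u] by (auto simp: fill_def clip_def max_def min_def split: if_splits)
    moreover have "H u k \<le> H u (k' - 1)" using * k by (intro H_mono[OF u]) auto
    ultimately have "H u (k - 1) + h (u k) \<le> t" using H_step[of k u] k by auto
    then have "fill u t (u k) = h (u k)"
      using permutes_inverses(2)[OF u] h_pos[OF uk(1)] by (auto simp: fill_def clip_def)
    then show False using late[of "u k"] * uk by auto
  qed
  have inj: "inj_on u {1..r}" using permutes_inj[OF u] by (meson inj_on_subset subset_UNIV)
  have "u ` {1..r} \<subseteq> {1..r}"
  proof (rule ccontr)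
    assume "\<not> u ` {1..r} \<subseteq> {1..r}"
    then obtain k where k: "k \<in> {1..r}" "u k \<notin> {1..r}" by blast
    then have "r < u k" using permutes_in[OF u, of k] r by auto
    \<comment> \<open>Pigeonhole: if a position \<open>k\<close> among the first \<open>r\<close>
      holds a value above \<open>r\<close>, then \<open>order\<close> puts all \<open>r\<close>
      small values at positions before \<open>k\<close>, and there are fewer than \<open>r\<close>
      of these.\<close>
    have sub: "{1..r} \<subseteq> u ` ({1..r} - {k})"
    proof (intro subsetI)
      fix i assume i: "i \<in> {1..r}"
      define k' where "k' = inv u i"
      have uk': "u k' = i" using permutes_inverses(1)[OF u] by (simp add: k'_def)
      have k': "k' \<in> {1..n}"
        using permutes_in_image[OF u, of k'] i r uk' by auto
      have "k' < k" using order[of k k'] k k' uk' i r \<open>r < u k\<close> by (metis atLeastAtMost_iff le_trans less_imp_le_nat not_le nat_neq_iff)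
      then have "k' \<in> {1..r} - {k}" using k k' by auto
      then show "i \<in> u ` ({1..r} - {k})" using uk' by blast
    qed
    have "card {1..r} \<le> card ({1..r} - {k})"
      using surj_card_le[OF _ sub] by simp
    then show False using k(1) r(1) by auto
  qed
  then have "u ` {1..r} = {1..r}"
    using inj by (simp add: card_image card_subset_eq)
  then show False using fs r unfolding fully_supported_def by blast
qed

subsection \<open>The polygon as a region\<close>

lemma path_edge_eq:
  assumes u: "u permutes {1..n}" and k: "1 \<le> k" "k \<le> n"
  shows "path_edge \<theta> u k = {z. H u (k - 1) \<le> - Im z \<and> - Im z \<le> H u k \<and> Re z = X u (- Im z)}"
proof -
  have uk: "u k \<in> {1..n}" using permutes_in[OF u] k by auto
  have Pk: "P u k = P u (k - 1) + cis (\<theta> (u k))" and Hk: "H u k = H u (k - 1) + h (u k)"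
    using P_step H_step k by auto
  have mem: "z \<in> path_edge \<theta> u k \<longleftrightarrow>
      (\<exists>s\<in>{0..1}. Re z = Re (P u (k - 1)) + c (u k) * (s * h (u k)) \<and> - Im z = H u (k - 1) + s * h (u k))"
    for z
    unfolding path_edge_def in_segment Pk complex_eq_iff
    by (auto simp: Re_cis_h[OF uk] Im_cis_h Im_P algebra_simps simp del: cis.sel)
  show ?thesis
  proof (intro set_eqI iffI)
    fix z assume "z \<in> path_edge \<theta> u k"
    then obtain s where s: "s \<in> {0..1}" "Re z = Re (P u (k - 1)) + c (u k) * (s * h (u k))"
      "- Im z = H u (k - 1) + s * h (u k)" unfolding mem by blast
    have "0 \<le> s * h (u k)" "s * h (u k) \<le> h (u k)"
      using s(1) h_pos[OF uk] by (auto simp: mult_left_le_one_le)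
    then show "z \<in> {z. H u (k - 1) \<le> - Im z \<and> - Im z \<le> H u k \<and> Re z = X u (- Im z)}"
      using X_on_edge[OF u k, of "s * h (u k)"] s Hk by (simp del: minus_mult_left)
  next
    fix z assume z: "z \<in> {z. H u (k - 1) \<le> - Im z \<and> - Im z \<le> H u k \<and> Re z = X u (- Im z)}"
    define s where "s = - Im z - H u (k - 1)"
    have "0 \<le> s" "s \<le> h (u k)" "- Im z = H u (k - 1) + s" using z Hk by (auto simp: s_def)
    then have "Re z = Re (P u (k - 1)) + c (u k) * s" using X_on_edge[OF u k, of s] z by auto
    then show "z \<in> path_edge \<theta> u k"
      unfolding mem using \<open>0 \<le> s\<close> \<open>s \<le> h (u k)\<close> \<open>- Im z = _\<close> h_pos[OF uk]
      by (intro bexI[of _ "s / h (u k)"]) auto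
  qed
qed

lemma path_edges_eq:
  assumes u: "u permutes {1..n}" "1 \<le> n"
  shows "(\<Union>k\<in>{1..n}. path_edge \<theta> u k) = {z. 0 \<le> - Im z \<and> - Im z \<le> H id n \<and> Re z = X u (- Im z)}"
proof (intro set_eqI iffI)
  fix z assume "z \<in> (\<Union>k\<in>{1..n}. path_edge \<theta> u k)"
  then obtain k where k: "1 \<le> k" "k \<le> n" "z \<in> path_edge \<theta> u k" by auto
  then have "H u (k - 1) \<le> - Im z \<and> - Im z \<le> H u k \<and> Re z = X u (- Im z)"
    using path_edge_eq[OF u(1) k(1,2)] by auto
  moreover have "0 \<le> H u (k - 1)" "H u k \<le> H id n"
    using H_mono[OF u(1), of 0 "k - 1"] H_mono[OF u(1), of k n] H_total[OF u(1)] k by auto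
  ultimately show "z \<in> {z. 0 \<le> - Im z \<and> - Im z \<le> H id n \<and> Re z = X u (- Im z)}" by auto
next
  fix z assume z: "z \<in> {z. 0 \<le> - Im z \<and> - Im z \<le> H id n \<and> Re z = X u (- Im z)}"
  then have "0 \<le> - Im z" "- Im z \<le> H id n" by auto
  from obtain_edge[OF u this]
  obtain k s where k: "1 \<le> k" "k \<le> n" "0 \<le> s" "s \<le> h (u k)" "- Im z = H u (k - 1) + s" .
  have "z \<in> path_edge \<theta> u k"
    unfolding path_edge_eq[OF u(1) k(1,2)] using z k H_step[of k u] by auto
  then show "z \<in> (\<Union>k\<in>{1..n}. path_edge \<theta> u k)" using k by auto
qed

lemma elnitsky_boundary_eq:
  assumes u: "u permutes {1..n}" "1 \<le> n"
  shows "elnitsky_boundary \<theta> n u =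
    {z. 0 \<le> - Im z \<and> - Im z \<le> H id n \<and> (Re z = X id (- Im z) \<or> Re z = X u (- Im z))}"
  unfolding elnitsky_boundary_def path_edges_eq[OF u] path_edges_eq[OF permutes_id u(2)] by auto

lemma X_top: "u permutes {1..n} \<Longrightarrow> 1 \<le> n \<Longrightarrow> X u 0 = 0"
  using X_at_vertex[of u 0] by simp

lemma X_bottom: "u permutes {1..n} \<Longrightarrow> 1 \<le> n \<Longrightarrow> X u (H id n) = Re (P id n)"
  using X_at_vertex[of u n] H_total[of u] P_total[of u] by simp

text \<open>The ray lies in the component of \<open>z\<close> in the complement of \<open>S\<close>,
  which is therefore unbounded. The sign \<open>e\<close> chooses between the rays to the right and
  to the left.\<close>

lemma not_inside_ray:
  fixes S :: "complex set"
  assumes "\<And>r. 0 \<le> r \<Longrightarrow> z + of_real (e * r) \<notin> S" "\<bar>e\<bar> = 1"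
  shows "z \<notin> inside S"
proof -
  define A where "A = (\<lambda>r. z + of_real (e * r)) ` {0..}"
  have "connected A" unfolding A_def
    by (intro connected_continuous_image continuous_intros) auto
  moreover have "z \<in> A" unfolding A_def by (auto intro!: image_eqI[of _ _ 0])
  moreover have "A \<subseteq> - S" using assms(1) by (auto simp: A_def)
  ultimately have sub: "A \<subseteq> connected_component_set (- S) z"
    by (intro connected_component_maximal) auto
  have "\<not> bounded A"
  proof
    assume "bounded A"
    then obtain B where B: "\<And>x. x \<in> A \<Longrightarrow> norm x \<le> B" by (auto simp: bounded_iff)
    define r where "r = \<bar>B\<bar> + norm z + 1"
    have "z + of_real (e * r) \<in> A" unfolding A_def by (rule imageI) (simp add: r_def)
    then have "norm (z + of_real (e * r)) \<le> B" by (rule B)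
    moreover have "norm (of_real (e * r) :: complex) = r"
      unfolding norm_of_real abs_mult using assms(2) by (simp add: r_def)
    moreover have "norm (of_real (e * r) :: complex) \<le> norm (z + of_real (e * r)) + norm z"
      by (metis add_diff_cancel_left' norm_triangle_ineq4)
    ultimately show False unfolding r_def by auto
  qed
  then show ?thesis unfolding inside_def using bounded_subset[OF _ sub] by blast
qed

text \<open>A point outside the region escapes along a horizontal ray. A point strictly between the
  graphs lies in the bounded open set \<open>U\<close>, whose frontier is part of the boundary
  curve; a connected set that avoids the curve cannot leave \<open>U\<close>, so the component of
  the point is bounded.\<close>

lemma elnitsky_polygon_eq_region:
  assumes u: "u permutes {1..n}" "1 \<le> n"
  shows "elnitsky_polygon \<theta> n u = region u"
proof
  have id: "id permutes {1..n}" by (rule permutes_id)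
  let ?B = "elnitsky_boundary \<theta> n u"
  note B = elnitsky_boundary_eq[OF u]
  show "elnitsky_polygon \<theta> n u \<subseteq> region u"
  proof
    fix z assume z: "z \<in> elnitsky_polygon \<theta> n u"
    show "z \<in> region u"
    proof (rule ccontr)
      assume no: "z \<notin> region u"
      then have "z \<notin> ?B" using X_id_le[OF u, of "- Im z"] by (auto simp: B region_def)
      then have z: "z \<in> inside ?B" using z by (auto simp: elnitsky_polygon_def)
      consider "\<not> (0 \<le> - Im z \<and> - Im z \<le> H id n)" | "0 \<le> - Im z" "- Im z \<le> H id n" "X u (- Im z) < Re z"
        | "0 \<le> - Im z" "- Im z \<le> H id n" "Re z < X id (- Im z)"
        using no unfolding region_def mem_Collect_eq by linarith
      then show False
      proof cases
        case 1
        then show False using not_inside_ray[of z 1 ?B] z by (auto simp: B)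
      next
        case 2
        then show False using not_inside_ray[of z 1 ?B] z X_id_le[OF u, of "- Im z"] by (auto simp: B)
      next
        case 3
        then show False using not_inside_ray[of z "-1" ?B] z X_id_le[OF u, of "- Im z"]
          by (auto simp: B)
      qed
    qed
  qed
  show "region u \<subseteq> elnitsky_polygon \<theta> n u"
  proof
    fix z assume z: "z \<in> region u"
    show "z \<in> elnitsky_polygon \<theta> n u"
    proof (cases "z \<in> ?B")
      case False
      define U where "U = {z. 0 < - Im z \<and> - Im z < H id n \<and> X id (- Im z) < Re z \<and> Re z < X u (- Im z)}"
      have edge: "X id (- Im z) = X u (- Im z)" if "- Im z = 0 \<or> - Im z = H id n"
        using that X_top[OF u] X_top[OF id u(2)] X_bottom[OF u] X_bottom[OF id u(2)] by auto
      have zU: "z \<in> U"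
        using z False edge unfolding U_def B region_def by (auto simp: less_le)
      have "U = {z. 0 < - Im z} \<inter> {z. - Im z < H id n} \<inter> {z. X id (- Im z) < Re z} \<inter> {z. Re z < X u (- Im z)}"
        by (auto simp: U_def)
      moreover have "open \<dots>"
        by (intro open_Int open_Collect_less continuous_intros)
      ultimately have "open U" by simp
      have clU: "closed (region u)"
      proof -
        have "region u = {z. 0 \<le> - Im z} \<inter> {z. - Im z \<le> H id n} \<inter> {z. X id (- Im z) \<le> Re z} \<inter> {z. Re z \<le> X u (- Im z)}"
          by (auto simp: region_def)
        moreover have "closed \<dots>"
          by (intro closed_Int closed_Collect_le continuous_intros)
        ultimately show ?thesis by simp
      qed
      have frontier: "frontier U \<subseteq> ?B"
      proof -
        have "closure U \<subseteq> region u"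
          by (rule closure_minimal[OF _ clU]) (auto simp: U_def region_def)
        moreover have "region u - U \<subseteq> ?B"
        proof
          fix y assume y: "y \<in> region u - U"
          have "X id (- Im y) = X u (- Im y)" if "- Im y = 0 \<or> - Im y = H id n"
            using that X_top[OF u] X_top[OF id u(2)] X_bottom[OF u] X_bottom[OF id u(2)] by auto
          then show "y \<in> ?B" using y unfolding U_def B region_def by (auto simp: less_le)
        qed
        ultimately show ?thesis unfolding frontier_def interior_open[OF \<open>open U\<close>] by blast
      qed
      let ?K = "connected_component_set (- ?B) z"
      have "?K \<subseteq> U"
      proof (rule ccontr)
        assume "\<not> ?K \<subseteq> U"
        moreover have "z \<in> ?K" using False by (simp add: connected_component_refl)
        ultimately have "?K \<inter> frontier U \<noteq> {}"
          using zU by (intro connected_Int_frontier connected_connected_component) blast+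
        then show False using frontier connected_component_subset[of "- ?B" z] by blast
      qed
      moreover have "bounded U"
      proof -
        \<comment> \<open>At each depth a point of \<open>U\<close> interpolates between the two
          graphs, so \<open>U\<close> lies in the continuous image of a rectangle.\<close>
        have "compact ((\<lambda>(s, t). Complex ((1 - s) * X id t + s * X u t) (- t)) ` ({0..1} \<times> {0..H id n}))"
          by (intro compact_continuous_image compact_Times compact_Icc)
             (auto simp: case_prod_unfold intro!: continuous_intros)
        moreover have "U \<subseteq> (\<lambda>(s, t). Complex ((1 - s) * X id t + s * X u t) (- t)) ` ({0..1} \<times> {0..H id n})"
        proof
          fix y assume y: "y \<in> U"
          define l r where "l = X id (- Im y)" and "r = X u (- Im y)"
          have "l < Re y" "Re y < r" using y by (auto simp: U_def l_def r_def)
          define s where "s = (Re y - l) / (r - l)"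
          have s: "(1 - s) * l + s * r = Re y" "s \<in> {0..1}"
            using \<open>l < Re y\<close> \<open>Re y < r\<close>
            by (auto simp: s_def divide_simps) (simp add: algebra_simps)
          have "y = Complex ((1 - s) * X id (- Im y) + s * X u (- Im y)) (- (- Im y))"
            using s by (simp add: complex_eq_iff l_def r_def)
          moreover have "(s, - Im y) \<in> {0..1} \<times> {0..H id n}"
            using s y by (auto simp: U_def)
          ultimately show "y \<in> (\<lambda>(s, t). Complex ((1 - s) * X id t + s * X u t) (- t)) ` ({0..1} \<times> {0..H id n})"
            by (intro image_eqI[of _ _ "(s, - Im y)"]) auto
        qed
        ultimately show ?thesis using bounded_subset compact_imp_bounded by blast
      qed
      ultimately have "z \<in> inside ?B"
        unfolding inside_def using False bounded_subset by blast
      then show ?thesis by (simp add: elnitsky_polygon_def)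
    qed (simp add: elnitsky_polygon_def)
  qed
qed

subsection \<open>Removing a tile\<close>

lemma convex_rhombus: "convex (rhombus \<theta> p i j)" and compact_rhombus: "compact (rhombus \<theta> p i j)"
proof -
  let ?f = "\<lambda>st. of_real (fst st) * cis (\<theta> i) + of_real (snd st) * cis (\<theta> j)"
  have eq: "rhombus \<theta> p i j = (+) p ` ?f ` ({0..1} \<times> {0..1})"
    unfolding rhombus_def by (force simp: image_iff add.assoc)
  have "linear ?f"
    by (rule linearI) (auto simp: algebra_simps scaleR_conv_of_real)
  then show "convex (rhombus \<theta> p i j)"
    unfolding eq by (intro convex_translation convex_linear_image convex_Times) auto
  show "compact (rhombus \<theta> p i j)"
    unfolding eq by (intro compact_translation compact_continuous_image compact_Times continuous_intros) auto
qed

text \<open>In contrast to \<^const>\<open>rhombic_tilings\<close> this makes sense for all permutations: a stretch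
  on which both boundary paths coincide is not covered by any tile.\<close>

definition tiling :: "(nat \<Rightarrow> nat) \<Rightarrow> complex set set \<Rightarrow> bool" where
  "tiling u T \<longleftrightarrow> finite T \<and>
     (\<forall>R\<in>T. \<exists>i\<in>{1..n}. \<exists>j\<in>{1..n}. \<exists>p. i < j \<and> R = rhombus \<theta> p i j) \<and>
     (\<forall>R\<in>T. R \<subseteq> region u) \<and>
     {z. 0 \<le> - Im z \<and> - Im z \<le> H id n \<and> X id (- Im z) < Re z \<and> Re z < X u (- Im z)} \<subseteq> \<Union>T \<and>
     pairwise (\<lambda>R S. R \<inter> S face_of R \<and> R \<inter> S face_of S) T"

text \<open>The depth has its own variable so that a computed value of \<open>- Im z\<close> can be
  passed in as it stands.\<close>

lemma region_depthD:
  "z \<in> region u \<Longrightarrow> - Im z = t \<Longrightarrow>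
    0 \<le> t \<and> t \<le> H id n \<and> X id t \<le> Re z \<and> Re z \<le> X u t"
  by (auto simp: region_def)

lemma interior_rhombus:
  assumes "i \<in> {1..n}" "j \<in> {1..n}" "i < j" "0 < Im p - Im z" "Im p - Im z < h i + h j"
    "G i j (Im p - Im z) < Re z - Re p" "Re z - Re p < G j i (Im p - Im z)"
  shows "z \<in> interior (rhombus \<theta> p i j)"
proof (rule interiorI)
  let ?U = "{z. 0 < Im p - Im z} \<inter> {z. Im p - Im z < h i + h j} \<inter>
    {z. G i j (Im p - Im z) < Re z - Re p} \<inter> {z. Re z - Re p < G j i (Im p - Im z)}"
  show "open ?U" by (intro open_Int open_Collect_less continuous_intros)
  show "z \<in> ?U" using assms by auto
  show "?U \<subseteq> rhombus \<theta> p i j" using mem_rhombus_iff[OF assms(1-3)] by auto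
qed

text \<open>A proper face misses the interior, so a common face that contains an interior point of
  both tiles equals both.\<close>

lemma overlapping_tiles_eq:
  fixes T :: "complex set set"
  assumes "pairwise (\<lambda>R S. R \<inter> S face_of R \<and> R \<inter> S face_of S) T" "R \<in> T" "S \<in> T"
    "z \<in> interior R" "z \<in> interior S"
  shows "R = S"
proof (rule ccontr)
  assume "R \<noteq> S"
  then have "R \<inter> S face_of R" "R \<inter> S face_of S"
    using assms(1-3) unfolding pairwise_def by blast+
  moreover have "z \<in> R \<inter> S" using assms(4,5) interior_subset by blast
  ultimately have "R \<inter> S = R" "R \<inter> S = S"
    using face_of_disjoint_interior[of "R \<inter> S" R] face_of_disjoint_interior[of "R \<inter> S" S] assms(4,5)
    by blast+
  then show False using \<open>R \<noteq> S\<close> by blast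
qed

lemma
  assumes "tiling u T"
  shows tiling_finite: "finite T"
    and tiling_tiles: "\<forall>R\<in>T. \<exists>i\<in>{1..n}. \<exists>j\<in>{1..n}. \<exists>p. i < j \<and> R = rhombus \<theta> p i j"
    and tiling_subset: "R \<in> T \<Longrightarrow> R \<subseteq> region u"
    and tiling_cover: "0 \<le> - Im z \<Longrightarrow> - Im z \<le> H id n \<Longrightarrow>
      X id (- Im z) < Re z \<Longrightarrow> Re z < X u (- Im z) \<Longrightarrow> z \<in> \<Union>T"
    and tiling_pairwise: "pairwise (\<lambda>R S. R \<inter> S face_of R \<and> R \<inter> S face_of S) T"
  using assms unfolding tiling_def subset_iff mem_Collect_eq by simp_all

lemma tiling_tileE:
  assumes "tiling u T" "R \<in> T"
  obtains p i j where "i \<in> {1..n}" "j \<in> {1..n}" "i < j" "R = rhombus \<theta> p i j"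
  using bspec[OF tiling_tiles[OF assms(1)] assms(2)] by blast

lemma closed_tile: "tiling u T \<Longrightarrow> R \<in> T \<Longrightarrow> closed R"
  by (metis tiling_tileE compact_rhombus compact_imp_closed)

lemma closed_Union_tiles:
  assumes "tiling u T" shows "closed (\<Union>T)"
  using assms closed_tile[OF assms] by (intro closed_Union) (auto simp: tiling_finite)

text \<open>Near the upper end of an edge of the right boundary, the tile to the left of that edge either
  has it as its upper right side, or contains that upper end away from its own top and bottom
  vertices.\<close>

lemma edge_tile:
  assumes u: "u permutes {1..n}" and T: "tiling u T" and k: "1 \<le> k" "k \<le> n"
    and d: "0 < d" "d \<le> h (u k)"
    and gap: "\<And>s. 0 < s \<Longrightarrow> s < d \<Longrightarrow> X id (H u (k - 1) + s) < X u (H u (k - 1) + s)"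
  obtains p i j \<delta> where "i \<in> {1..n}" "j \<in> {1..n}" "i < j" "rhombus \<theta> p i j \<in> T"
    "0 < \<delta>" "P u (k - 1) + Complex (c (u k) * \<delta>) (- \<delta>) \<in> rhombus \<theta> p i j"
    "p = P u (k - 1) \<and> j = u k \<or>
      (\<exists>e>0. \<forall>x. 0 < x \<and> x < e \<longrightarrow> P u (k - 1) - of_real x \<in> interior (rhombus \<theta> p i j))"
proof -
  define m Q where "m = u k" and "Q = P u (k - 1)"
  define pt where "pt s = Q + Complex (c m * s) (- s)" for s
  have m: "m \<in> {1..n}" using permutes_in[OF u] k by (simp add: m_def)
  have Xpt: "X u (H u (k - 1) + s) = Re Q + c m * s" if "0 \<le> s" "s \<le> d" for s
    using X_on_edge[OF u k, of s] that d by (simp add: m_def Q_def)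
  have ImQ: "Im Q = - H u (k - 1)" by (simp add: Q_def Im_P)
  have range: "0 \<le> H u (k - 1) + s" "H u (k - 1) + s \<le> H id n" if "0 \<le> s" "s \<le> d" for s
    using H_mono[OF u, of 0 "k - 1"] H_mono[OF u, of k n] H_total[OF u] H_step[of k u] that d k
    by auto
  \<comment> \<open>Points slightly to the left of the edge are covered by assumption. The tiles are
    closed and finitely many, so the limit point on the edge is covered too.\<close>
  have cover: "pt s \<in> \<Union>T" if s: "0 < s" "s < d" for s
  proof -
    define g where "g = X u (H u (k - 1) + s) - X id (H u (k - 1) + s)"
    have g: "0 < g" using gap[OF s] by (simp add: g_def)
    have "(\<lambda>x. pt s - of_real x) ` closure {0<..<g} \<subseteq> \<Union>T"
    proof (rule image_closure_subset)
      show "(\<lambda>x. pt s - of_real x) ` {0<..<g} \<subseteq> \<Union>T"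
      proof (intro image_subsetI)
        fix x assume x: "x \<in> {0<..<g}"
        have "- Im (pt s - of_real x) = H u (k - 1) + s" "Re (pt s - of_real x) = Re Q + c m * s - x"
          by (simp_all add: pt_def ImQ)
        moreover have "Re Q + c m * s = X u (H u (k - 1) + s)" using Xpt s by simp
        ultimately show "pt s - of_real x \<in> \<Union>T"
          using range[of s] s x by (intro tiling_cover[OF T]) (auto simp: g_def)
      qed
    qed (auto intro: closed_Union_tiles[OF T] continuous_intros)
    moreover have "0 \<in> closure {0<..<g}" using g by simp
    ultimately have "pt s - of_real 0 \<in> \<Union>T" by blast
    then show ?thesis by simp
  qed
  \<comment> \<open>The tiles that miss \<open>Q\<close> form a closed set, so near \<open>Q\<close>
    the edge can only be covered by tiles that contain \<open>Q\<close>.\<close>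
  define C where "C = \<Union>{R \<in> T. Q \<notin> R}"
  have "closed C"
    using tiling_finite[OF T] closed_tile[OF T] unfolding C_def by (intro closed_Union) auto
  moreover have "Q \<notin> C" by (auto simp: C_def)
  ultimately obtain e where e: "0 < e" "ball Q e \<subseteq> - C"
    by (metis ComplI open_Compl open_contains_ball)
  \<comment> \<open>The second bound makes
    \<open>\<bar>c m * \<delta>\<bar> + \<bar>\<delta>\<bar>\<close> at most \<open>e / 2\<close>,
    which keeps \<open>pt \<delta>\<close> in the ball; the first keeps it in the stretch where the
    gap is known.\<close>
  define \<delta> where "\<delta> = min (d / 2) (e / (2 * (\<bar>c m\<bar> + 1)))"
  have \<delta>: "0 < \<delta>" "\<delta> < d" using d e by (auto simp: \<delta>_def)
  have "dist Q (pt \<delta>) \<le> \<bar>c m * \<delta>\<bar> + \<bar>\<delta>\<bar>"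
    using cmod_le[of "Complex (c m * \<delta>) (- \<delta>)"] by (simp add: pt_def dist_norm)
  also have "\<dots> = (\<bar>c m\<bar> + 1) * \<delta>" using \<delta> by (simp add: abs_mult algebra_simps)
  also have "\<dots> \<le> (\<bar>c m\<bar> + 1) * (e / (2 * (\<bar>c m\<bar> + 1)))"
    by (intro mult_left_mono) (auto simp: \<delta>_def)
  also have "\<dots> = e / 2" by (simp add: add_nonneg_eq_0_iff field_simps)
  also have "\<dots> < e" using e by simp
  finally have "pt \<delta> \<notin> C" using e by auto
  then obtain R where R: "R \<in> T" "pt \<delta> \<in> R" "Q \<in> R"
    using cover[OF \<delta>] by (auto simp: C_def)
  obtain p i j where ij: "i \<in> {1..n}" "j \<in> {1..n}" "i < j" and Rp: "R = rhombus \<theta> p i j"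
    using tiling_tileE[OF T R(1)] .
  note mem = mem_rhombus_iff[OF ij]
  have seg: "pt s \<in> R" if s: "0 \<le> s" "s \<le> \<delta>" for s
  proof -
    have "pt s = (1 - s / \<delta>) *\<^sub>R Q + (s / \<delta>) *\<^sub>R pt \<delta>"
      using \<delta> by (simp add: pt_def complex_eq_iff field_simps)
    then show ?thesis
      using convexD[OF convex_rhombus, of Q p i j "pt \<delta>" "1 - s / \<delta>" "s / \<delta>"] R s \<delta> by (simp add: Rp)
  qed
  define \<sigma> x0 where "\<sigma> = Im p - Im Q" and "x0 = Re Q - Re p"
  \<comment> \<open>The right side of the tile cannot pass the graph of \<open>X u\<close>, yet
    points of that graph belong to the tile. So along this segment the edge runs on the right side
    of the tile.\<close>
  have eq: "0 \<le> \<sigma> + s \<and> \<sigma> + s \<le> h i + h j \<and> G j i (\<sigma> + s) = x0 + c m * s"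
    if s: "0 \<le> s" "s \<le> \<delta>" for s
  proof -
    have dpt: "Im p - Im (pt s) = \<sigma> + s" "Re (pt s) - Re p = x0 + c m * s"
      by (simp_all add: pt_def \<sigma>_def x0_def)
    have 1: "0 \<le> \<sigma> + s" "\<sigma> + s \<le> h i + h j" "x0 + c m * s \<le> G j i (\<sigma> + s)"
      using seg[OF s] unfolding Rp mem dpt by auto
    define z where "z = p + Complex (G j i (\<sigma> + s)) (- (\<sigma> + s))"
    have "z \<in> R" unfolding Rp mem z_def using 1 G_le[OF ij] by auto
    then have "z \<in> region u" using tiling_subset[OF T R(1)] by blast
    moreover have "- Im z = H u (k - 1) + s" by (simp add: z_def \<sigma>_def ImQ)
    ultimately have "Re z \<le> X u (H u (k - 1) + s)" by (simp only: region_depthD)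
    then have "Re p + G j i (\<sigma> + s) \<le> X u (H u (k - 1) + s)" by (simp add: z_def)
    then have "Re p + G j i (\<sigma> + s) \<le> Re Q + c m * s" using Xpt[of s] s \<delta> by simp
    with 1 show ?thesis by (simp add: x0_def)
  qed
  \<comment> \<open>\<open>\<sigma>\<close> is the depth of \<open>Q\<close> below the top of the
    tile. If it is 0, then \<open>Q\<close> is the top vertex and the first side on the right has
    slope \<open>c m\<close>. Otherwise the tile has positive width at the depth of
    \<open>Q\<close>, and points just left of \<open>Q\<close> are interior.\<close>
  have "p = Q \<and> j = m \<or> (\<exists>e>0. \<forall>x. 0 < x \<and> x < e \<longrightarrow> Q - of_real x \<in> interior R)"
  proof (cases "\<sigma> = 0")
    case True
    note hj = h_pos[OF ij(2)] and hi = h_pos[OF ij(1)]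
    have "G j i 0 = 0" using hi hj by (simp add: G_def clip_def)
    then have "x0 = 0" using eq[of 0] True \<delta> by simp
    then have "p = Q" using True by (simp add: complex_eq_iff x0_def \<sigma>_def)
    define s where "s = min \<delta> (h j)"
    have s: "0 < s" "s \<le> \<delta>" "s \<le> h j" using \<delta> hj by (auto simp: s_def)
    have "G j i s = c j * s" using s hi by (simp add: G_def clip_def)
    then have "c j * s = c m * s" using eq[of s] s True \<open>x0 = 0\<close> by simp
    then have "j = m" using s c_eq_iff[OF ij(2) m] by simp
    then show ?thesis using \<open>p = Q\<close> by blast
  next
    case False
    then have \<sigma>: "0 < \<sigma>" "\<sigma> < h i + h j" using eq[of 0] eq[of \<delta>] \<delta> by auto
    have "G i j \<sigma> < G j i \<sigma>" using G_less[OF ij \<sigma>] .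
    also have "G j i \<sigma> = x0" using eq[of 0] \<delta> by simp
    finally have gap: "0 < x0 - G i j \<sigma>" by simp
    have "Q - of_real x \<in> interior R" if "0 < x \<and> x < x0 - G i j \<sigma>" for x
      unfolding Rp using that \<sigma> \<open>G j i \<sigma> = x0\<close>
      by (intro interior_rhombus[OF ij]) (auto simp: \<sigma>_def x0_def)
    then show ?thesis using gap by blast
  qed
  then show ?thesis
    using that[OF ij R(1)[unfolded Rp] \<delta>(1)] R(2) unfolding Rp m_def Q_def pt_def by blast
qed

text \<open>Below boundary edge \<open>k\<close> the tile continues along a side with label
  \<open>i\<close>; it can be removed when edge \<open>k + 1\<close> also has the label
  \<open>i\<close>.\<close>

definition upper_right_tile :: "(nat \<Rightarrow> nat) \<Rightarrow> complex set set \<Rightarrow> nat \<Rightarrow> nat \<Rightarrow> bool" where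
  "upper_right_tile u T k i \<longleftrightarrow> i \<in> {1..n} \<and> i < u k \<and> rhombus \<theta> (P u (k - 1)) i (u k) \<in> T"

text \<open>At the first moved position \<open>a\<close> the label exceeds \<open>a\<close>, so the
  boundaries part at vertex \<open>a - 1\<close>, where they still coincide. No point of the region
  lies to the left of that vertex at its depth, which rules out the second alternative of
  \<open>edge_tile\<close>.\<close>

lemma upper_right_tile_exists:
  assumes u: "u permutes {1..n}" and T: "tiling u T" and "u \<noteq> id"
  shows "\<exists>k i. 1 \<le> k \<and> k \<le> n \<and> upper_right_tile u T k i"
proof -
  have id: "id permutes {1..n}" by (rule permutes_id)
  have "\<exists>a. u a \<noteq> a" using \<open>u \<noteq> id\<close> by auto
  then obtain a where a: "u a \<noteq> a" "\<And>b. b < a \<Longrightarrow> u b = b" using exists_least_iff[of "\<lambda>a. u a \<noteq> a"] by auto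
  have a_in: "a \<in> {1..n}" using a(1) u by (meson permutes_not_in)
  then have k: "1 \<le> a" "a \<le> n" by auto
  have ua: "u a \<in> {1..n}" using permutes_in[OF u k] .
  have "a < u a"
  proof (rule ccontr)
    assume "\<not> a < u a"
    then have "u (u a) = u a" using a by auto
    then show False using a(1) permutes_inj[OF u] by (simp add: inj_eq)
  qed
  have HP: "H u (a - 1) = H id (a - 1)" "P u (a - 1) = P id (a - 1)"
    unfolding H_def path_vertex_def using a(2) k by (auto intro!: sum.cong)
  \<comment> \<open>For this much depth both boundaries run along a single edge, so the slopes
    decide.\<close>
  define d where "d = min (h a) (h (u a))"
  have d: "0 < d" "d \<le> h (u a)" "d \<le> h a" using h_pos[OF ua] h_pos[OF a_in] by (auto simp: d_def)
  have gap: "X id (H u (a - 1) + s) < X u (H u (a - 1) + s)" if "0 < s" "s < d" for s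
    using X_on_edge[OF u k, of s] X_on_edge[OF id k, of s] HP that d c_less[OF a_in ua \<open>a < u a\<close>] by auto
  obtain p i j \<delta> where R: "i \<in> {1..n}" "j \<in> {1..n}" "i < j" "rhombus \<theta> p i j \<in> T"
    "p = P u (a - 1) \<and> j = u a \<or>
      (\<exists>e>0. \<forall>x. 0 < x \<and> x < e \<longrightarrow> P u (a - 1) - of_real x \<in> interior (rhombus \<theta> p i j))"
    using edge_tile[OF u T k d(1,2) gap] by metis
  from R(5) show ?thesis
  proof
    assume "p = P u (a - 1) \<and> j = u a"
    then show ?thesis using R(1,3,4) k unfolding upper_right_tile_def by blast
  next
    assume "\<exists>e>0. \<forall>x. 0 < x \<and> x < e \<longrightarrow> P u (a - 1) - of_real x \<in> interior (rhombus \<theta> p i j)"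
    then obtain e where e: "0 < e"
      "\<And>x. 0 < x \<Longrightarrow> x < e \<Longrightarrow> P u (a - 1) - of_real x \<in> interior (rhombus \<theta> p i j)" by blast
    define x where "x = e / 2"
    have x: "0 < x" "x < e" using e(1) by (auto simp: x_def)
    have "P u (a - 1) - of_real x \<in> region u"
      using e(2)[OF x] tiling_subset[OF T R(4)] interior_subset by blast
    moreover have "- Im (P u (a - 1) - of_real x) = H id (a - 1)" using HP by (simp add: Im_P)
    ultimately have "X id (H id (a - 1)) \<le> Re (P u (a - 1) - of_real x)" by (simp only: region_depthD)
    then have "X id (H id (a - 1)) \<le> Re (P id (a - 1)) - x" using HP by simp
    moreover have "a - 1 \<le> n" "1 \<le> n" using k by linarith+
    ultimately show ?thesis using X_at_vertex[OF id, of "a - 1"] x by linarith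
  qed
qed

text \<open>The lower right side of the tile, of slope \<open>c i\<close>, hangs below vertex
  \<open>k\<close> inside the region; so a next edge exists and its slope is at least
  \<open>c i\<close>. If it is larger, a wedge opens between that side and edge
  \<open>k + 1\<close>. The tile found there by \<open>edge_tile\<close> is not the present one and
  therefore begins at vertex \<open>k\<close>.\<close>

lemma upper_right_tile_next:
  assumes u: "u permutes {1..n}" and T: "tiling u T" and k: "1 \<le> k" "k \<le> n"
    and tile: "upper_right_tile u T k i"
  shows "k < n" "i = u (Suc k) \<or> (\<exists>i'. upper_right_tile u T (Suc k) i')"
proof -
  define R0 where "R0 = rhombus \<theta> (P u (k - 1)) i (u k)"
  have i: "i \<in> {1..n}" "i < u k" and R0: "R0 \<in> T"
    using tile by (auto simp: upper_right_tile_def R0_def)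
  have uk: "u k \<in> {1..n}" using permutes_in[OF u k] .
  note mem = mem_rhombus_iff[OF i(1) uk i(2)]
  have hi: "0 < h i" and hk: "0 < h (u k)" using h_pos i uk by auto
  define Q where "Q = P u k"
  have ImQ: "Im Q = - H u k" by (simp add: Q_def Im_P)
  have dQ: "Im (P u (k - 1)) - Im Q = h (u k)" "Re Q - Re (P u (k - 1)) = c (u k) * h (u k)"
    using P_step[OF k(1), of u] Re_cis_h[OF uk] Im_cis_h[of "u k"] by (simp_all add: Q_def del: cis.sel)
  have G_low: "G (u k) i (h (u k) + s) = c (u k) * h (u k) + c i * s" if "0 \<le> s" "s \<le> h i" for s
    using that hi hk by (simp add: G_def clip_def)
  have low: "Re Q + c i * s \<le> X u (H u k + s) \<and> X id (H u k + s) \<le> Re Q + c i * s \<and> H u k + s \<le> H id n"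
    if s: "0 \<le> s" "s \<le> h i" for s
  proof -
    define z where "z = Q + Complex (c i * s) (- s)"
    have dz: "Im (P u (k - 1)) - Im z = h (u k) + s"
      "Re z - Re (P u (k - 1)) = c (u k) * h (u k) + c i * s"
      using dQ by (auto simp: z_def)
    have "z \<in> R0"
      unfolding R0_def mem dz G_low[OF s] using s hk G_le[OF i(1) uk i(2), of "h (u k) + s"] G_low[OF s] by auto
    then have "z \<in> region u" using tiling_subset[OF T R0] by blast
    moreover have "- Im z = H u k + s" by (simp add: z_def ImQ)
    ultimately have "X id (H u k + s) \<le> Re z \<and> Re z \<le> X u (H u k + s) \<and> H u k + s \<le> H id n"
      by (simp only: region_depthD)
    then show ?thesis by (simp add: z_def)
  qed
  show kn: "k < n"
  proof (rule ccontr)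
    assume "\<not> k < n"
    then have "k = n" using k by simp
    then show False using low[of "h i"] hi H_total[OF u] by simp
  qed
  define m where "m = u (Suc k)"
  have m: "m \<in> {1..n}" using permutes_in[OF u, of "Suc k"] kn by (simp add: m_def)
  have hm: "0 < h m" using h_pos[OF m] .
  define d where "d = min (h i) (h m)"
  have d: "0 < d" "d \<le> h m" "d \<le> h i" using hi hm by (auto simp: d_def)
  have Xm: "X u (H u k + s) = Re Q + c m * s" if "0 \<le> s" "s \<le> d" for s
    using X_on_edge[OF u, of "Suc k" s] that d kn by (simp add: m_def Q_def)
  have "c i * d \<le> c m * d" using low[of d] Xm[of d] d by auto
  then have "c i \<le> c m" using d by simp
  show "i = u (Suc k) \<or> (\<exists>i'. upper_right_tile u T (Suc k) i')"
  proof (cases "i = m")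
    case False
    then have im: "c i < c m" using \<open>c i \<le> c m\<close> c_eq_iff[OF i(1) m] by simp
    have gap: "X id (H u (Suc k - 1) + s) < X u (H u (Suc k - 1) + s)" if "0 < s" "s < d" for s
    proof -
      have "c i * s < c m * s" using im that by simp
      moreover have "X id (H u k + s) \<le> Re Q + c i * s" using low[of s] that d by auto
      moreover have "X u (H u k + s) = Re Q + c m * s" using Xm[of s] that by auto
      ultimately show ?thesis unfolding diff_Suc_1 by linarith
    qed
    have Sk: "1 \<le> Suc k" "Suc k \<le> n" "d \<le> h (u (Suc k))" using kn d by (auto simp: m_def)
    obtain p i' j' \<delta> where R: "i' \<in> {1..n}" "j' \<in> {1..n}" "i' < j'" "rhombus \<theta> p i' j' \<in> T"
      "0 < \<delta>" "P u (Suc k - 1) + Complex (c (u (Suc k)) * \<delta>) (- \<delta>) \<in> rhombus \<theta> p i' j'"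
      "p = P u (Suc k - 1) \<and> j' = u (Suc k) \<or>
        (\<exists>e>0. \<forall>x. 0 < x \<and> x < e \<longrightarrow> P u (Suc k - 1) - of_real x \<in> interior (rhombus \<theta> p i' j'))"
      using edge_tile[OF u T Sk(1,2) d(1) Sk(3) gap] by metis
    have "p = P u (Suc k - 1) \<and> j' = u (Suc k)"
    proof (rule ccontr)
      assume "\<not> (p = P u (Suc k - 1) \<and> j' = u (Suc k))"
      then obtain e where e: "0 < e"
        "\<And>x. 0 < x \<Longrightarrow> x < e \<Longrightarrow> Q - of_real x \<in> interior (rhombus \<theta> p i' j')"
        using R(7) by (auto simp: Q_def)
      \<comment> \<open>The width of the present tile to the left of \<open>Q\<close>, at the depth
        of \<open>Q\<close>. Points within it and close to \<open>Q\<close> would be interior to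
        both tiles; the tiles would coincide, although the present one contains no points of edge
        \<open>k + 1\<close> below \<open>Q\<close>.\<close>
      define w where "w = c (u k) * h (u k) - G i (u k) (h (u k))"
      have w: "0 < w"
        using G_less[OF i(1) uk i(2), of "h (u k)"] G_low[of 0] hi hk by (simp add: w_def)
      define x where "x = min e w / 2"
      have x: "0 < x" "x < e" "x < w" using e(1) w by (auto simp: x_def)
      have "Q - of_real x \<in> interior R0"
        unfolding R0_def
        using dQ G_low[of 0] hi hk x by (intro interior_rhombus[OF i(1) uk i(2)]) (auto simp: w_def)
      then have "R0 = rhombus \<theta> p i' j'"
        using overlapping_tiles_eq[OF tiling_pairwise[OF T] R0 R(4) _ e(2)[OF x(1,2)]] by blast
      then have pt: "Q + Complex (c m * \<delta>) (- \<delta>) \<in> R0" using R(6) by (simp add: Q_def m_def)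
      have dz: "Im (P u (k - 1)) - Im (Q + Complex (c m * \<delta>) (- \<delta>)) = h (u k) + \<delta>"
        "Re (Q + Complex (c m * \<delta>) (- \<delta>)) - Re (P u (k - 1)) = c (u k) * h (u k) + c m * \<delta>"
        using dQ by auto
      have "\<delta> \<le> h i" and "c m * \<delta> \<le> c i * \<delta>"
        using pt G_low[of \<delta>] R(5) unfolding R0_def mem dz by auto
      then show False using im R(5) by simp
    qed
    then show ?thesis using R(1,3,4) unfolding upper_right_tile_def by auto
  qed (simp add: m_def)
qed

text \<open>Each use of \<open>upper_right_tile_next\<close> either finds a removable tile or moves
  one edge down, and it cannot pass the bottom because it also gives \<open>k < n\<close>.\<close>

lemma removable_tile:
  assumes u: "u permutes {1..n}" and T: "tiling u T" and "u \<noteq> id"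
  obtains k where "1 \<le> k" "k < n" "u (Suc k) < u k"
    "rhombus \<theta> (P u (k - 1)) (u (Suc k)) (u k) \<in> T"
proof -
  have "\<exists>k. 1 \<le> k \<and> k < n \<and> upper_right_tile u T k (u (Suc k))"
    if "1 \<le> k" "k \<le> n" "upper_right_tile u T k i" for k i
    using that
  proof (induction "n - k" arbitrary: k i rule: less_induct)
    case less
    note next_tile = upper_right_tile_next[OF u T less.prems]
    from next_tile(2) show ?case
    proof
      assume "i = u (Suc k)"
      then show ?thesis using less.prems next_tile(1) by blast
    next
      assume "\<exists>i'. upper_right_tile u T (Suc k) i'"
      then show ?thesis using less.hyps[of "Suc k"] next_tile(1) by auto
    qed
  qed
  then show ?thesis
    using upper_right_tile_exists[OF assms] that unfolding upper_right_tile_def by blast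
qed

text \<open>The point to check is that the other tiles stay to the left of the new boundary: all of
  the old region beyond it belongs to the removed tile, which the others do not overlap.\<close>

lemma tiling_remove_tile:
  assumes u: "u permutes {1..n}" and T: "tiling u T" and k: "1 \<le> k" "k < n" "u (Suc k) < u k"
    and R: "rhombus \<theta> (P u (k - 1)) (u (Suc k)) (u k) \<in> T" (is "?R \<in> T")
  shows "tiling (swap u k) (T - {?R})"
proof -
  note mem = mem_corner_rhombus_iff[OF u k]
  have in_R: "z \<in> ?R" if "z \<in> region u" "X (swap u k) (- Im z) < Re z" for z
    unfolding mem using that X_swap_eq[OF u k(1,2), of "- Im z"]
    by (force simp: region_def not_le)
  have sub: "S \<subseteq> region (swap u k)" if S: "S \<in> T - {?R}" for S
  proof
    fix z assume z: "z \<in> S"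
    have Su: "S \<subseteq> region u" using tiling_subset[OF T] S by blast
    show "z \<in> region (swap u k)"
    proof (rule ccontr)
      assume "z \<notin> region (swap u k)"
      then have right: "X (swap u k) (- Im z) < Re z" using z Su by (auto simp: region_def)
      define V where "V = {z. X (swap u k) (- Im z) < Re z}"
      have V: "open V" "z \<in> V"
        unfolding V_def using right by (auto intro!: open_Collect_less continuous_intros)
      obtain p i j where ij: "i \<in> {1..n}" "j \<in> {1..n}" "i < j" and Sp: "S = rhombus \<theta> p i j"
        using tiling_tileE[OF T] S by blast
      \<comment> \<open>The offending point may lie on the rim of \<open>S\<close>. Since
        \<open>S\<close> is the closure of its interior, some interior point of \<open>S\<close>
        also lies to the right of the new boundary.\<close>
      have "interior S \<noteq> {}"
      proof -
        define \<sigma> where "\<sigma> = (h i + h j) / 2"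
        have \<sigma>: "0 < \<sigma>" "\<sigma> < h i + h j" using h_pos ij by (auto simp: \<sigma>_def add_pos_pos)
        have "p + Complex ((G i j \<sigma> + G j i \<sigma>) / 2) (- \<sigma>) \<in> interior S"
          unfolding Sp using \<sigma> G_less[OF ij \<sigma>] by (intro interior_rhombus[OF ij]) auto
        then show ?thesis by blast
      qed
      then have "closure (interior S) = closure S"
        by (intro convex_closure_interior) (auto simp: Sp convex_rhombus)
      then have "z \<in> closure (interior S)" using z closure_subset by blast
      then obtain z' where z': "z' \<in> interior S" "z' \<in> V"
        using V by (meson closure_iff_nhds_not_empty disjoint_iff open_Int subset_refl)
      have "interior S \<inter> V \<subseteq> ?R"
        using in_R Su interior_subset unfolding V_def by blast
      then have "z' \<in> interior ?R"
        using z' V by (intro interiorI[of "interior S \<inter> V"]) auto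
      then have "S = ?R" using S R z' by (intro overlapping_tiles_eq[OF tiling_pairwise[OF T], of S ?R z']) auto
      then show False using S by blast
    qed
  qed
  have cover: "z \<in> \<Union>(T - {?R})"
    if z: "0 \<le> - Im z" "- Im z \<le> H id n" "X id (- Im z) < Re z" "Re z < X (swap u k) (- Im z)" for z
  proof -
    have "Re z < X u (- Im z)" using X_swap_le[OF u k, of "- Im z"] z by linarith
    then have "z \<in> \<Union>T" using z by (intro tiling_cover[OF T])
    moreover have "z \<notin> ?R" using z unfolding mem by auto
    ultimately show ?thesis by blast
  qed
  show ?thesis
    unfolding tiling_def
  proof (intro conjI ballI subsetI)
    show "finite (T - {?R})" using tiling_finite[OF T] by simp
    show "pairwise (\<lambda>R S. R \<inter> S face_of R \<and> R \<inter> S face_of S) (T - {?R})"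
      using tiling_pairwise[OF T] by (rule pairwise_subset) blast
    show "z \<in> \<Union>(T - {?R})"
      if "z \<in> {z. 0 \<le> - Im z \<and> - Im z \<le> H id n \<and> X id (- Im z) < Re z \<and>
        Re z < X (swap u k) (- Im z)}" for z
      using that cover by blast
    show "z \<in> region (swap u k)" if "S \<in> T - {?R}" "z \<in> S" for S z
      using sub that by blast
    show "\<exists>i\<in>{1..n}. \<exists>j\<in>{1..n}. \<exists>p. i < j \<and> S = rhombus \<theta> p i j" if "S \<in> T - {?R}" for S
      using tiling_tiles[OF T] that by simp
  qed
qed

end

lemma closed_segment_endpoint_faces:
  fixes a b :: "'a::euclidean_space"
  shows "{a} face_of closed_segment a b" "{b} face_of closed_segment a b"
  using extreme_point_of_segment[of a a b] extreme_point_of_segment[of b a b]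
  by (auto simp: face_of_singleton)

lemma face_of_both_if_le_singleton:
  assumes "A \<inter> B \<subseteq> {v}" "{v} face_of A" "{v} face_of B"
  shows "A \<inter> B face_of A" "A \<inter> B face_of B"
proof -
  have "A \<inter> B = {v}" using assms face_of_imp_subset by blast
  then show "A \<inter> B face_of A" "A \<inter> B face_of B" using assms by simp_all
qed

context elnitsky
begin

subsection \<open>Attaching a tile\<close>

lemma rhombus_commute: "rhombus \<theta> p i j = rhombus \<theta> p j i"
  unfolding rhombus_def by (auto; metis add.assoc add.commute)

lemma sin_angle_diff:
  assumes "i \<in> {1..n}" "j \<in> {1..n}" "i < j"
  shows "0 < sin (\<theta> j - \<theta> i)"
proof -
  have "\<theta> i < \<theta> j" "pi < \<theta> i" "\<theta> j < 2 * pi"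
    using admissible assms unfolding admissible_angles_def strict_mono_on_def by auto
  then show ?thesis by (intro sin_gt_zero) auto
qed

lemma rhombus_sides:
  assumes ij: "i \<in> {1..n}" "j \<in> {1..n}" "i \<noteq> j"
  shows "closed_segment p (p + cis (\<theta> i)) face_of rhombus \<theta> p i j"
    and "closed_segment (p + cis (\<theta> j)) (p + cis (\<theta> j) + cis (\<theta> i)) face_of rhombus \<theta> p i j"
proof -
  \<comment> \<open>The direction \<open>cis (\<theta> i)\<close> turned by a right angle: the inner
    product with \<open>a\<close> is constant along sides with label \<open>i\<close> and changes at
    rate \<open>d\<close> in the other direction. So supporting lines cut out these two sides; the
    sign of \<open>d\<close> decides which inequality holds.\<close>
  define a where "a = Complex (- sin (\<theta> i)) (cos (\<theta> i))"
  define d where "d = sin (\<theta> j - \<theta> i)"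
  have d0: "d \<noteq> 0"
    using sin_angle_diff[of i j] sin_angle_diff[of j i] ij sin_minus[of "\<theta> j - \<theta> i"]
    by (cases "i < j") (auto simp: d_def)
  have dot: "a \<bullet> (p + of_real s * cis (\<theta> i) + of_real t * cis (\<theta> j)) = a \<bullet> p + t * d" for s t
    by (simp add: a_def d_def inner_complex_def sin_diff algebra_simps)
  have in_eq: "closed_segment q (q + v) = {q + of_real s * v | s. s \<in> {0..1}}" for q v :: complex
    unfolding closed_segment_def by (auto simp: algebra_simps scaleR_conv_of_real)
  have face: "rhombus \<theta> p i j \<inter> {x. a \<bullet> x = a \<bullet> p + t0 * d} face_of rhombus \<theta> p i j"
    if "t0 = 0 \<or> t0 = 1" for t0
  proof -
    have bound: "a \<bullet> x \<in> {a \<bullet> p + t * d | t. t \<in> {0..1}}" if "x \<in> rhombus \<theta> p i j" for x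
      using that dot unfolding rhombus_def by blast
    have "(\<forall>x\<in>rhombus \<theta> p i j. a \<bullet> x \<le> a \<bullet> p + t0 * d) \<or> (\<forall>x\<in>rhombus \<theta> p i j. a \<bullet> p + t0 * d \<le> a \<bullet> x)"
    proof -
      have "(\<forall>t\<in>{0..1}. t * d \<le> t0 * d) \<or> (\<forall>t\<in>{0..1}. t0 * d \<le> t * d)"
      proof (cases "0 \<le> d")
        case True
        then have "0 * d \<le> t * d \<and> t * d \<le> 1 * d" if "t \<in> {0..1}" for t
          using that by (intro conjI mult_right_mono) auto
        then show ?thesis using \<open>t0 = 0 \<or> t0 = 1\<close> by metis
      next
        case False
        then have "1 * d \<le> t * d \<and> t * d \<le> 0 * d" if "t \<in> {0..1}" for t
          using that by (intro conjI mult_right_mono_neg) auto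
        then show ?thesis using \<open>t0 = 0 \<or> t0 = 1\<close> by metis
      qed
      then show ?thesis using bound by fastforce
    qed
    then show ?thesis
      using face_of_Int_supporting_hyperplane_le[OF convex_rhombus]
        face_of_Int_supporting_hyperplane_ge[OF convex_rhombus] by blast
  qed
  have "rhombus \<theta> p i j \<inter> {x. a \<bullet> x = a \<bullet> p + 0 * d} = closed_segment p (p + cis (\<theta> i))"
  proof (intro set_eqI iffI)
    fix x assume "x \<in> rhombus \<theta> p i j \<inter> {x. a \<bullet> x = a \<bullet> p + 0 * d}"
    then obtain s t where st: "s \<in> {0..1}" "x = p + of_real s * cis (\<theta> i) + of_real t * cis (\<theta> j)"
      and "a \<bullet> x = a \<bullet> p" unfolding rhombus_def by auto
    then have "t = 0" using dot d0 by simp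
    then show "x \<in> closed_segment p (p + cis (\<theta> i))" unfolding in_eq using st by auto
  next
    fix x assume "x \<in> closed_segment p (p + cis (\<theta> i))"
    then obtain s where s: "s \<in> {0..1}" "x = p + of_real s * cis (\<theta> i) + of_real 0 * cis (\<theta> j)"
      unfolding in_eq by auto
    have "x \<in> rhombus \<theta> p i j"
      unfolding rhombus_def using s by (intro CollectI exI[of _ s] exI[of _ 0]) auto
    moreover have "a \<bullet> x = a \<bullet> p + 0 * d" unfolding s(2) by (rule dot)
    ultimately show "x \<in> rhombus \<theta> p i j \<inter> {x. a \<bullet> x = a \<bullet> p + 0 * d}" by blast
  qed
  then show "closed_segment p (p + cis (\<theta> i)) face_of rhombus \<theta> p i j"
    using face[of 0] by simp
  have "rhombus \<theta> p i j \<inter> {x. a \<bullet> x = a \<bullet> p + 1 * d} =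
      closed_segment (p + cis (\<theta> j)) (p + cis (\<theta> j) + cis (\<theta> i))"
  proof (intro set_eqI iffI)
    fix x assume "x \<in> rhombus \<theta> p i j \<inter> {x. a \<bullet> x = a \<bullet> p + 1 * d}"
    then obtain s t where st: "s \<in> {0..1}" "x = p + of_real s * cis (\<theta> i) + of_real t * cis (\<theta> j)"
      and "a \<bullet> x = a \<bullet> p + 1 * d" unfolding rhombus_def by auto
    then have "t * d = 1 * d" using dot by simp
    then have "t = 1" using d0 by simp
    then show "x \<in> closed_segment (p + cis (\<theta> j)) (p + cis (\<theta> j) + cis (\<theta> i))"
      unfolding in_eq using st by auto
  next
    fix x assume "x \<in> closed_segment (p + cis (\<theta> j)) (p + cis (\<theta> j) + cis (\<theta> i))"
    then obtain s where s: "s \<in> {0..1}" "x = p + of_real s * cis (\<theta> i) + of_real 1 * cis (\<theta> j)"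
      unfolding in_eq by auto
    have "x \<in> rhombus \<theta> p i j"
      unfolding rhombus_def using s by (intro CollectI exI[of _ s] exI[of _ 1]) auto
    moreover have "a \<bullet> x = a \<bullet> p + 1 * d" unfolding s(2) by (rule dot)
    ultimately show "x \<in> rhombus \<theta> p i j \<inter> {x. a \<bullet> x = a \<bullet> p + 1 * d}" by blast
  qed
  then show "closed_segment (p + cis (\<theta> j)) (p + cis (\<theta> j) + cis (\<theta> i)) face_of rhombus \<theta> p i j"
    using face[of 1] by simp
qed

text \<open>Used for \<open>u\<close> this gives the right sides of a corner tile, and used for
  \<open>swap u k\<close> the left sides of the same tile.\<close>

lemma two_edges_face_of_rhombus:
  assumes u: "u permutes {1..n}" and k: "1 \<le> k" "k < n"
  shows "path_edge \<theta> u k face_of rhombus \<theta> (P u (k - 1)) (u k) (u (Suc k))"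
    and "path_edge \<theta> u (Suc k) face_of rhombus \<theta> (P u (k - 1)) (u k) (u (Suc k))"
proof -
  have lab: "u k \<in> {1..n}" "u (Suc k) \<in> {1..n}" using permutes_in[OF u] k by auto
  have ne: "u k \<noteq> u (Suc k)" using permutes_inj[OF u] by (simp add: inj_eq)
  show "path_edge \<theta> u k face_of rhombus \<theta> (P u (k - 1)) (u k) (u (Suc k))"
    using rhombus_sides(1)[OF lab ne, of "P u (k - 1)"] P_step[OF k(1), of u]
    by (simp add: path_edge_def del: cis.sel)
  show "path_edge \<theta> u (Suc k) face_of rhombus \<theta> (P u (k - 1)) (u k) (u (Suc k))"
    using rhombus_sides(2)[OF lab(2,1) ne[symmetric], of "P u (k - 1)"] P_step[OF k(1), of u]
    by (simp add: path_edge_def P_Suc rhombus_commute[of _ "u k"] del: cis.sel)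
qed

text \<open>The intersections with the edges of the right boundary are recorded so that a tile attached
  to that boundary meets the other tiles in faces.\<close>

definition fitted_tiling :: "(nat \<Rightarrow> nat) \<Rightarrow> complex set set \<Rightarrow> bool" where
  "fitted_tiling u T \<longleftrightarrow> tiling u T \<and> (\<forall>S\<in>T. \<forall>m\<in>{1..n}.
     S \<inter> path_edge \<theta> u m face_of S \<and> S \<inter> path_edge \<theta> u m face_of path_edge \<theta> u m)"

lemma eq_path_vertex:
  assumes "u permutes {1..n}" "k \<le> n" "1 \<le> n" "Re z = X u (- Im z)" "- Im z = H u k"
  shows "z = P u k"
  using X_at_vertex[OF assms(1-3)] assms(4,5) Im_P[of u k] by (simp add: complex_eq_iff)

lemma path_edge_endpoint_faces:
  "{P u (k - 1)} face_of path_edge \<theta> u k" "{P u k} face_of path_edge \<theta> u k"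
  unfolding path_edge_def by (rule closed_segment_endpoint_faces)+

text \<open>The graph for \<open>swap u k\<close> separates the old tiles from the new one, so they
  can meet only in the left sides of the new tile, where fittedness supplies the faces. To restore
  fittedness for \<open>u\<close>, note that the two new boundary edges touch old tiles at most at
  their outer ends.\<close>

lemma fitted_tiling_add_tile:
  assumes u: "u permutes {1..n}" and k: "1 \<le> k" "k < n" "u (Suc k) < u k"
    and T: "fitted_tiling (swap u k) T"
  shows "fitted_tiling u (insert (rhombus \<theta> (P u (k - 1)) (u (Suc k)) (u k)) T)"
    (is "fitted_tiling u (insert ?R T)")
proof -
  let ?u = "swap u k"
  note u' = swap_permutes[OF u k(1,2)]
  have til: "tiling ?u T" and fit: "\<And>S m. S \<in> T \<Longrightarrow> m \<in> {1..n} \<Longrightarrow>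
      S \<inter> path_edge \<theta> ?u m face_of S \<and> S \<inter> path_edge \<theta> ?u m face_of path_edge \<theta> ?u m"
    using T unfolding fitted_tiling_def by blast+
  have n1: "1 \<le> n" using k by simp
  note mem = mem_corner_rhombus_iff[OF u k]
  have lab: "u (Suc k) \<in> {1..n}" "u k \<in> {1..n}" using permutes_in[OF u] k by auto
  have HP: "H ?u (k - 1) = H u (k - 1)" "H ?u (Suc k) = H u (Suc k)"
    "P ?u (k - 1) = P u (k - 1)" "P ?u (Suc k) = P u (Suc k)"
    using k H_swap[of k "k - 1" u] H_swap[of k "Suc k" u] P_swap[of k "k - 1" u] P_swap[of k "Suc k" u]
    by auto
  have Hk: "H u (k - 1) < H u k" "H u k < H u (Suc k)" "H ?u (k - 1) < H ?u k" "H ?u k < H ?u (Suc k)"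
    using H_step[OF k(1), of u] H_step[OF k(1), of ?u] H_Suc[of u k] H_Suc[of ?u k]
      h_pos[OF lab(1)] h_pos[OF lab(2)] by auto
  have right: "path_edge \<theta> u k face_of ?R" "path_edge \<theta> u (Suc k) face_of ?R"
    using two_edges_face_of_rhombus[OF u k(1,2)] rhombus_commute by simp_all
  have left: "path_edge \<theta> ?u k face_of ?R" "path_edge \<theta> ?u (Suc k) face_of ?R"
    using two_edges_face_of_rhombus[OF u' k(1,2)] HP by simp_all
  have sub_u: "z \<in> region u \<and> Re z \<le> X ?u (- Im z)" if "S \<in> T" "z \<in> S" for S z
  proof -
    have "z \<in> region ?u" using tiling_subset[OF til that(1)] that(2) by blast
    then show ?thesis using X_swap_le[OF u k, of "- Im z"] by (auto simp: region_def)
  qed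
  have meet: "S \<inter> ?R face_of S \<and> S \<inter> ?R face_of ?R" if S: "S \<in> T" for S
  proof -
    have two: "S \<inter> ?R \<subseteq> path_edge \<theta> ?u k \<union> path_edge \<theta> ?u (Suc k)"
    proof
      fix z assume z: "z \<in> S \<inter> ?R"
      then have "H u (k - 1) \<le> - Im z" "- Im z \<le> H u (Suc k)" "Re z = X ?u (- Im z)"
        using sub_u[OF S, of z] mem[of z] by auto
      then show "z \<in> path_edge \<theta> ?u k \<union> path_edge \<theta> ?u (Suc k)"
        using path_edge_eq[OF u' k(1)] path_edge_eq[OF u', of "Suc k"] k HP by auto
    qed
    have "convex S" using tiling_tileE[OF til S] convex_rhombus by metis
    then have conv: "convex (S \<inter> ?R)" by (intro convex_Int convex_rhombus)
    \<comment> \<open>Take one point of the intersection off each of the two sides. By convexity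
      their midpoint lies on one of the sides, and that side, being a face of the new tile, would
      contain both points.\<close>
    have "\<exists>m\<in>{k, Suc k}. S \<inter> ?R \<subseteq> path_edge \<theta> ?u m"
    proof (rule ccontr)
      assume "\<not> ?thesis"
      then obtain y z where yz: "y \<in> S \<inter> ?R" "z \<in> S \<inter> ?R" "y \<notin> path_edge \<theta> ?u k" "z \<notin> path_edge \<theta> ?u (Suc k)"
        by blast
      define m where "m = midpoint y z"
      have "y \<noteq> z" using yz two by blast
      then have m: "m \<in> open_segment y z" by (simp add: m_def)
      then have "m \<in> S \<inter> ?R"
        using conv yz unfolding convex_contains_open_segment by blast
      then consider "m \<in> path_edge \<theta> ?u k" | "m \<in> path_edge \<theta> ?u (Suc k)" using two by blast
      then show False
      proof cases
        case 1
        then show False using face_ofD[OF left(1) m] yz by blast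
      next
        case 2
        then show False using face_ofD[OF left(2) m] yz by blast
      qed
    qed
    then obtain m where m: "m \<in> {k, Suc k}" "S \<inter> ?R \<subseteq> path_edge \<theta> ?u m" by blast
    have side: "path_edge \<theta> ?u m face_of ?R" using m(1) left by blast
    then have "S \<inter> ?R = S \<inter> path_edge \<theta> ?u m" using m(2) face_of_imp_subset by blast
    moreover have "m \<in> {1..n}" using m(1) k by auto
    ultimately show ?thesis using fit[OF S] face_of_trans[OF _ side] by auto
  qed
  have edge_other: "path_edge \<theta> u m = path_edge \<theta> ?u m" if "m \<noteq> k" "m \<noteq> Suc k" for m
  proof -
    have "m - 1 \<noteq> k" using that k by (cases m) auto
    then show ?thesis using that k P_swap[of k m u] P_swap[of k "m - 1" u] by (simp add: path_edge_def)
  qed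
  have top: "S \<inter> path_edge \<theta> u k face_of S \<and> S \<inter> path_edge \<theta> u k face_of path_edge \<theta> u k"
    if S: "S \<in> T" for S
  proof (cases "S \<inter> path_edge \<theta> u k = {}")
    case False
    \<comment> \<open>Between its ends and at its lower end, edge \<open>k\<close> is strictly to
      the right of the old boundary, out of reach of the old tiles.\<close>
    have sub: "S \<inter> path_edge \<theta> u k \<subseteq> {P u (k - 1)}"
    proof
      fix z assume z: "z \<in> S \<inter> path_edge \<theta> u k"
      then have e: "H u (k - 1) \<le> - Im z" "- Im z \<le> H u k" "Re z = X u (- Im z)"
        using path_edge_eq[OF u k(1)] k by auto
      have "- Im z < H u (Suc k)" using e(2) Hk(2) by linarith
      moreover have "X u (- Im z) \<le> X ?u (- Im z)" using sub_u[OF S, of z] z e(3) by simp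
      ultimately have "\<not> H u (k - 1) < - Im z" using X_swap_less[OF u k, of "- Im z"] by linarith
      then have "- Im z = H u (k - 1)" using e(1) by linarith
      then show "z \<in> {P u (k - 1)}" using eq_path_vertex[OF u _ n1 e(3), of "k - 1"] k by simp
    qed
    then have "P u (k - 1) \<in> S" using False by blast
    \<comment> \<open>The shared vertex is also an end of the old edge \<open>k\<close>, which meets
      \<open>S\<close> in a face of \<open>S\<close>; a face of a face is a face.\<close>
    then have "{P ?u (k - 1)} \<subseteq> S \<inter> path_edge \<theta> ?u k" using HP by (simp add: path_edge_def)
    then have "{P ?u (k - 1)} face_of S \<inter> path_edge \<theta> ?u k"
      by (rule face_of_subset[OF path_edge_endpoint_faces(1)]) blast
    then have "{P u (k - 1)} face_of S" using fit[OF S, of k] k face_of_trans HP by auto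
    then show ?thesis
      using face_of_both_if_le_singleton[OF sub] path_edge_endpoint_faces(1)[of u k] by blast
  qed simp
  have bottom: "S \<inter> path_edge \<theta> u (Suc k) face_of S \<and>
      S \<inter> path_edge \<theta> u (Suc k) face_of path_edge \<theta> u (Suc k)" if S: "S \<in> T" for S
  proof (cases "S \<inter> path_edge \<theta> u (Suc k) = {}")
    case False
    have sub: "S \<inter> path_edge \<theta> u (Suc k) \<subseteq> {P u (Suc k)}"
    proof
      fix z assume z: "z \<in> S \<inter> path_edge \<theta> u (Suc k)"
      then have e: "H u k \<le> - Im z" "- Im z \<le> H u (Suc k)" "Re z = X u (- Im z)"
        using path_edge_eq[OF u, of "Suc k"] k by auto
      have "H u (k - 1) < - Im z" using e(1) Hk(1) by linarith
      moreover have "X u (- Im z) \<le> X ?u (- Im z)" using sub_u[OF S, of z] z e(3) by simp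
      ultimately have "\<not> - Im z < H u (Suc k)" using X_swap_less[OF u k, of "- Im z"] by linarith
      then have "- Im z = H u (Suc k)" using e(2) by linarith
      then show "z \<in> {P u (Suc k)}" using eq_path_vertex[OF u _ n1 e(3), of "Suc k"] k by simp
    qed
    then have "P u (Suc k) \<in> S" using False by blast
    then have "{P ?u (Suc k)} \<subseteq> S \<inter> path_edge \<theta> ?u (Suc k)" using HP by (simp add: path_edge_def)
    then have "{P ?u (Suc k)} face_of S \<inter> path_edge \<theta> ?u (Suc k)"
      by (rule face_of_subset[OF path_edge_endpoint_faces(2)]) blast
    then have "{P u (Suc k)} face_of S" using fit[OF S, of "Suc k"] k face_of_trans HP by auto
    then show ?thesis
      using face_of_both_if_le_singleton[OF sub] path_edge_endpoint_faces(2)[of u "Suc k"] by blast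
  qed simp
  \<comment> \<open>Edges other than \<open>k\<close> and \<open>k + 1\<close> lie at depths above
    or below the new tile and can touch it only at its top or bottom vertex.\<close>
  have new: "?R \<inter> path_edge \<theta> u m face_of ?R \<and> ?R \<inter> path_edge \<theta> u m face_of path_edge \<theta> u m"
    if m: "m \<in> {1..n}" for m
  proof -
    have e: "H u (m - 1) \<le> - Im z \<and> - Im z \<le> H u m \<and> Re z = X u (- Im z)" if "z \<in> path_edge \<theta> u m" for z
      using path_edge_eq[OF u, of m] m that by auto
    consider "m < k" | "m = k \<or> m = Suc k" | "Suc k < m" by linarith
    then show ?thesis
    proof cases
      case 1
      have eq: "z = P u (k - 1) \<and> z = P u m" if z: "z \<in> ?R \<inter> path_edge \<theta> u m" for z
      proof -
        have "H u m \<le> H u (k - 1)" using 1 k by (intro H_mono[OF u]) auto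
        then have "- Im z = H u (k - 1)" "- Im z = H u m" using z e[of z] mem[of z] by auto
        then show ?thesis
          using eq_path_vertex[OF u _ n1, of "k - 1" z] eq_path_vertex[OF u _ n1, of m z] e[of z] z m k by auto
      qed
      have "{P u (k - 1)} face_of ?R" using face_of_trans[OF path_edge_endpoint_faces(1) right(1)] .
      then show ?thesis
      proof (cases "?R \<inter> path_edge \<theta> u m = {}")
        case False
        then have "P u (k - 1) = P u m" using eq by blast
        then show ?thesis
          using face_of_both_if_le_singleton[of ?R "path_edge \<theta> u m" "P u m"] eq
            \<open>{P u (k - 1)} face_of ?R\<close> path_edge_endpoint_faces(2)[of u m] by auto
      qed simp
    next
      case 2
      then have "path_edge \<theta> u m face_of ?R" using right by blast
      moreover from this have "?R \<inter> path_edge \<theta> u m = path_edge \<theta> u m"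
        using face_of_imp_subset by blast
      ultimately show ?thesis by (simp add: face_of_refl path_edge_def)
    next
      case 3
      have eq: "z = P u (Suc k) \<and> z = P u (m - 1)" if z: "z \<in> ?R \<inter> path_edge \<theta> u m" for z
      proof -
        have "H u (Suc k) \<le> H u (m - 1)" using 3 m by (intro H_mono[OF u]) auto
        then have "- Im z = H u (Suc k)" "- Im z = H u (m - 1)" using z e[of z] mem[of z] by auto
        then show ?thesis
          using eq_path_vertex[OF u _ n1, of "Suc k" z] eq_path_vertex[OF u _ n1, of "m - 1" z] e[of z] z m k
          by auto
      qed
      have "{P u (Suc k)} face_of ?R" using face_of_trans[OF path_edge_endpoint_faces(2) right(2)] .
      then show ?thesis
      proof (cases "?R \<inter> path_edge \<theta> u m = {}")
        case False
        then have "P u (Suc k) = P u (m - 1)" using eq by blast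
        then show ?thesis
          using face_of_both_if_le_singleton[of ?R "path_edge \<theta> u m" "P u (m - 1)"] eq
            \<open>{P u (Suc k)} face_of ?R\<close> path_edge_endpoint_faces(1)[of u m] by auto
      qed simp
    qed
  qed
  have "tiling u (insert ?R T)"
    unfolding tiling_def
  proof (intro conjI ballI subsetI)
    show "finite (insert ?R T)" using tiling_finite[OF til] by simp
    show "\<exists>i\<in>{1..n}. \<exists>j\<in>{1..n}. \<exists>p. i < j \<and> S = rhombus \<theta> p i j" if "S \<in> insert ?R T" for S
      using that tiling_tiles[OF til] lab k(3) by (metis insertE)
    show "z \<in> region u" if "S \<in> insert ?R T" "z \<in> S" for S z
    proof (cases "S \<in> T")
      case True
      then show ?thesis using sub_u that by blast
    next
      case False
      then have z: "H u (k - 1) \<le> - Im z" "- Im z \<le> H u (Suc k)" "X ?u (- Im z) \<le> Re z" "Re z \<le> X u (- Im z)"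
        using that mem[of z] by auto
      moreover have "0 \<le> H u (k - 1)" "H u (Suc k) \<le> H id n"
        using H_mono[OF u, of 0 "k - 1"] H_mono[OF u, of "Suc k" n] H_total[OF u] k by auto
      ultimately show ?thesis using X_id_le[OF u' n1, of "- Im z"] by (auto simp: region_def)
    qed
    show "z \<in> \<Union>(insert ?R T)"
      if "z \<in> {z. 0 \<le> - Im z \<and> - Im z \<le> H id n \<and> X id (- Im z) < Re z \<and> Re z < X u (- Im z)}" for z
    proof (cases "Re z < X ?u (- Im z)")
      case True
      then show ?thesis using tiling_cover[OF til, of z] that by auto
    next
      case False
      then have "z \<in> ?R" unfolding mem using that X_swap_eq[OF u k(1,2), of "- Im z"] by force
      then show ?thesis by blast
    qed
    show "pairwise (\<lambda>R S. R \<inter> S face_of R \<and> R \<inter> S face_of S) (insert ?R T)"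
      using tiling_pairwise[OF til] meet by (auto simp: pairwise_insert Int_commute)
  qed
  moreover have "S \<inter> path_edge \<theta> u m face_of S \<and> S \<inter> path_edge \<theta> u m face_of path_edge \<theta> u m"
    if "S \<in> insert ?R T" "m \<in> {1..n}" for S m
  proof (cases "S = ?R")
    case True
    then show ?thesis using new that by simp
  next
    case False
    then show ?thesis using that top bottom fit edge_other by (metis insertE)
  qed
  ultimately show ?thesis unfolding fitted_tiling_def by blast
qed

section \<open>Existence of tilings, also with a prescribed tile at the bottom\<close>

lemma descent_exists:
  assumes u: "u permutes {1..n}" and "u \<noteq> id"
  shows "\<exists>k. 1 \<le> k \<and> k < n \<and> u (Suc k) < u k"
proof (rule ccontr)
  assume no: "\<not> ?thesis"
  have mono: "u i \<le> u j" if "1 \<le> i" "i \<le> j" "j \<le> n" for i j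
    using that(2,3)
  proof (induction j rule: dec_induct)
    case (step j)
    then show ?case using no that(1) by (metis Suc_leD Suc_le_lessD le_trans not_less)
  qed simp
  have "\<exists>a. u a \<noteq> a" using \<open>u \<noteq> id\<close> by auto
  then obtain a where a: "u a \<noteq> a" "\<And>b. b < a \<Longrightarrow> u b = b"
    using exists_least_iff[of "\<lambda>a. u a \<noteq> a"] by auto
  have a_in: "a \<in> {1..n}" using a(1) u by (meson permutes_not_in)
  have less: "\<not> u b < a" if "u b \<noteq> b" for b
    using a(2)[of "u b"] that permutes_inj[OF u] by (auto simp: inj_eq)
  define b where "b = inv u a"
  have b: "u b = a" using permutes_inverses(1)[OF u] by (simp add: b_def)
  have "b \<noteq> a" using a(1) b by auto
  moreover have "\<not> b < a" using a(2)[of b] b by auto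
  ultimately have "a < b" by simp
  moreover have "b \<in> {1..n}" using permutes_in_image[OF u, of b] b a_in by simp
  ultimately have "u a \<le> a" using mono[of a b] a_in b by auto
  then show False using less[OF a(1)] a(1) by simp
qed

text \<open>The exchange lowers the weighted sum by \<open>u k - u (Suc k)\<close>; it serves as the
  induction measure in place of the number of inversions.\<close>

lemma weight_swap_less:
  assumes k: "1 \<le> k" "k < n" "u (Suc k) < u k"
  shows "(\<Sum>i = 1..n. (n - i) * swap u k i) < (\<Sum>i = 1..n. (n - i) * u i)"
proof -
  have split: "(\<Sum>i = 1..n. (n - i) * v i) =
    (\<Sum>i\<in>{1..n} - {k, Suc k}. (n - i) * v i) + ((n - k) * v k + (n - Suc k) * v (Suc k))" for v :: "nat \<Rightarrow> nat"
    using k by (subst sum.subset_diff[of "{k, Suc k}"]) auto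
  have "(\<Sum>i\<in>{1..n} - {k, Suc k}. (n - i) * swap u k i) = (\<Sum>i\<in>{1..n} - {k, Suc k}. (n - i) * u i)"
    by (intro sum.cong) auto
  moreover have "n - k = Suc (n - Suc k)" using k by simp
  ultimately show ?thesis unfolding split[of u] split[of "swap u k"] using k by simp
qed

lemma fitted_tiling_exists: "u permutes {1..n} \<Longrightarrow> \<exists>T. fitted_tiling u T"
proof (induction "\<Sum>i = 1..n. (n - i) * u i" arbitrary: u rule: less_induct)
  case less
  show ?case
  proof (cases "u = id")
    case True
    \<comment> \<open>Both boundaries coincide, so there is nothing to cover.\<close>
    have "fitted_tiling id {}" unfolding fitted_tiling_def tiling_def by auto
    then show ?thesis using True by blast
  next
    case False
    then obtain k where k: "1 \<le> k" "k < n" "u (Suc k) < u k"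
      using descent_exists[OF less.prems] by blast
    obtain T where "fitted_tiling (swap u k) T"
      using less.hyps[OF weight_swap_less[OF k] swap_permutes[OF less.prems k(1,2)]] by blast
    then show ?thesis using fitted_tiling_add_tile[OF less.prems k] by blast
  qed
qed

text \<open>The tile is located from the bottom vertex because exchanges before the last position
  change neither that vertex nor the last entry. The entries between position \<open>q\<close> and
  the end are smaller than \<open>u n\<close>, hence than \<open>u q\<close>; so \<open>u q\<close>
  moves right through descents, and its exchange with the last entry attaches the tile.\<close>

lemma fitted_tiling_with_bottom_tile:
  assumes "u permutes {1..n}" "1 \<le> q" "q < n" "u n < u q" "\<And>i. q < i \<Longrightarrow> i < n \<Longrightarrow> u i < u n"
  shows "\<exists>T. fitted_tiling u T \<and>
    rhombus \<theta> (P u n - cis (\<theta> (u n)) - cis (\<theta> (u q))) (u n) (u q) \<in> T"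
  using assms
proof (induction "n - q" arbitrary: q u rule: less_induct)
  case less
  note u = less.prems(1)
  have k: "1 \<le> q" "q < n" "u (Suc q) < u q"
    using less.prems(2-4) less.prems(5)[of "Suc q"] by (cases "Suc q = n"; simp)+
  note u' = swap_permutes[OF u k(1,2)]
  show ?case
  proof (cases "Suc q = n")
    case True
    obtain T where "fitted_tiling (swap u q) T" using fitted_tiling_exists[OF u'] by blast
    from fitted_tiling_add_tile[OF u k this]
    have "fitted_tiling u (insert (rhombus \<theta> (P u (q - 1)) (u n) (u q)) T)" using True by simp
    moreover have "P u (q - 1) = P u n - cis (\<theta> (u n)) - cis (\<theta> (u q))"
      using P_step[OF k(1), of u] P_Suc[of u q] True by simp
    ultimately show ?thesis by auto
  next
    case False
    then have q: "Suc q < n" using k by simp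
    have "\<exists>T. fitted_tiling (swap u q) T \<and>
      rhombus \<theta> (P (swap u q) n - cis (\<theta> (swap u q n)) - cis (\<theta> (swap u q (Suc q)))) (swap u q n) (swap u q (Suc q)) \<in> T"
      using less.prems q by (intro less.hyps[OF _ u']) auto
    then obtain T where T: "fitted_tiling (swap u q) T"
      "rhombus \<theta> (P u n - cis (\<theta> (u n)) - cis (\<theta> (u q))) (u n) (u q) \<in> T"
      using q k P_swap[of q n u] by auto
    then show ?thesis using fitted_tiling_add_tile[OF u k T(1)] by blast
  qed
qed

subsection \<open>The tile at the bottom vertex\<close>

lemma tiling_of_rhombic_tiling:
  assumes w: "w permutes {1..n}" "1 \<le> n" and T: "T \<in> rhombic_tilings \<theta> n w"
  shows "tiling w T"
proof -
  have fin: "finite T" and lab: "\<And>R. R \<in> T \<Longrightarrow> \<exists>L. has_label_set \<theta> n R L" and un: "\<Union>T = region w"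
    and pw: "pairwise (\<lambda>R S. R \<inter> S face_of R \<and> R \<inter> S face_of S) T"
    using T elnitsky_polygon_eq_region[OF w] unfolding rhombic_tilings_def by auto
  have "\<exists>i\<in>{1..n}. \<exists>j\<in>{1..n}. \<exists>p. i < j \<and> R = rhombus \<theta> p i j" if "R \<in> T" for R
  proof -
    obtain i j p where "i \<in> {1..n}" "j \<in> {1..n}" "i \<noteq> j" "R = rhombus \<theta> p i j"
      using lab[OF \<open>R \<in> T\<close>] unfolding has_label_set_def by blast
    then show ?thesis using rhombus_commute[of p i j] by (metis nat_neq_iff)
  qed
  moreover have "{z. 0 \<le> - Im z \<and> - Im z \<le> H id n \<and> X id (- Im z) < Re z \<and> Re z < X w (- Im z)} \<subseteq> \<Union>T"
    unfolding un region_def by auto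
  ultimately show ?thesis unfolding tiling_def using fin un pw by blast
qed

text \<open>\<open>tiling\<close> only asks to cover points strictly between the graphs. By full
  support every intermediate depth has such points, and since the union of the tiles is closed, the
  boundary follows by limits: along each row first, then along the right boundary for the top and
  bottom vertices.\<close>

lemma rhombic_tiling_of_tiling:
  assumes w: "w permutes {1..n}" "2 \<le> n" "fully_supported n w" and T: "tiling w T"
  shows "T \<in> rhombic_tilings \<theta> n w"
proof -
  have n1: "1 \<le> n" using w by simp
  have id: "id permutes {1..n}" by (rule permutes_id)
  have "0 < h 1" using w by (intro h_pos) auto
  then have total: "0 < H id n" using H_mono[OF id, of 1 n] w by (simp add: H_def)
  have cl: "closed (\<Union>T)" using closed_Union_tiles[OF T] .
  have row: "Complex ((1 - s) * X id t + s * X w t) (- t) \<in> \<Union>T"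
    if s: "s \<in> {0..1}" and t: "0 < t" "t < H id n" for s t
  proof -
    have lt: "X id t < X w t" using X_id_less[OF w(1,3,2) t] .
    have "(\<lambda>s. Complex ((1 - s) * X id t + s * X w t) (- t)) ` closure {0<..<1} \<subseteq> \<Union>T"
    proof (rule image_closure_subset)
      show "continuous_on (closure {0<..<1}) (\<lambda>s. Complex ((1 - s) * X id t + s * X w t) (- t))"
        by (intro continuous_intros)
      show "(\<lambda>s. Complex ((1 - s) * X id t + s * X w t) (- t)) ` {0<..<1} \<subseteq> \<Union>T"
      proof (intro image_subsetI)
        fix s :: real assume s: "s \<in> {0<..<1}"
        then have "0 < s * (X w t - X id t)" "0 < (1 - s) * (X w t - X id t)" using lt by auto
        then show "Complex ((1 - s) * X id t + s * X w t) (- t) \<in> \<Union>T"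
          using t by (intro tiling_cover[OF T]) (auto simp: algebra_simps)
      qed
    qed (rule cl)
    moreover have "s \<in> closure {0<..<1::real}" using s by simp
    ultimately show ?thesis by (rule subsetD[OF _ imageI])
  qed
  have "region w \<subseteq> \<Union>T"
  proof
    fix z assume z: "z \<in> region w"
    define t where "t = - Im z"
    have zt: "0 \<le> t" "t \<le> H id n" "X id t \<le> Re z" "Re z \<le> X w t"
      using z by (auto simp: region_def t_def)
    show "z \<in> \<Union>T"
    proof (cases "0 < t \<and> t < H id n")
      case True
      then have lt: "X id t < X w t" using X_id_less[OF w(1,3,2)] by blast
      define s where "s = (Re z - X id t) / (X w t - X id t)"
      have "s \<in> {0..1}" "(1 - s) * X id t + s * X w t = Re z"
        using lt zt unfolding s_def by (auto simp: divide_simps) (simp add: algebra_simps)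
      moreover have "z = Complex (Re z) (- t)" by (simp add: t_def)
      ultimately show ?thesis using row[of s t] True by metis
    next
      case False
      then have "t = 0 \<or> t = H id n" using zt by auto
      then have "X id t = X w t"
        using X_top[OF w(1) n1] X_top[OF id n1] X_bottom[OF w(1) n1] X_bottom[OF id n1] by auto
      then have eq: "z = Complex (X w t) (- t)" using zt by (simp add: complex_eq_iff t_def)
      have "(\<lambda>t. Complex (X w t) (- t)) ` closure {0<..<H id n} \<subseteq> \<Union>T"
      proof (rule image_closure_subset)
        show "continuous_on (closure {0<..<H id n}) (\<lambda>t. Complex (X w t) (- t))"
          by (intro continuous_intros)
        show "(\<lambda>t. Complex (X w t) (- t)) ` {0<..<H id n} \<subseteq> \<Union>T"
          using row[of 1] by (auto simp: image_subset_iff)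
      qed (rule cl)
      moreover have "t \<in> closure {0<..<H id n}" using total zt by simp
      ultimately show ?thesis unfolding eq by (rule subsetD[OF _ imageI])
    qed
  qed
  then have "\<Union>T = elnitsky_polygon \<theta> n w"
    using tiling_subset[OF T] elnitsky_polygon_eq_region[OF w(1) n1] by blast
  moreover have "\<exists>L. has_label_set \<theta> n R L" if "R \<in> T" for R
  proof -
    obtain p i j where "i \<in> {1..n}" "j \<in> {1..n}" "i < j" "R = rhombus \<theta> p i j"
      using tiling_tileE[OF T \<open>R \<in> T\<close>] .
    then have "has_label_set \<theta> n R {i, j}" unfolding has_label_set_def by (metis nat_neq_iff)
    then show ?thesis by blast
  qed
  ultimately show ?thesis
    unfolding rhombic_tilings_def using tiling_finite[OF T] tiling_pairwise[OF T] by simp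
qed

lemma G_above_bottom:
  assumes "i \<in> {1..n}" "j \<in> {1..n}" "0 \<le> s" "s \<le> h i"
  shows "G j i (h i + h j - s) = c i * h i + c j * h j - c i * s"
  using assms h_pos[OF assms(1)] h_pos[OF assms(2)] by (simp add: G_def clip_def algebra_simps)

text \<open>The bottom vertex \<open>B\<close> of the polygon lies in the tile and nothing in the
  region is deeper, so it is also the bottom vertex of the tile. Just above \<open>B\<close> the
  tile extends exactly between the slopes \<open>c x\<close> and \<open>c y\<close>. Containing the
  left edge forces \<open>y = n\<close>; containing the right edge and staying in the region forces
  \<open>x = w n\<close>.\<close>

lemma bottom_tile_labels:
  assumes w: "w permutes {1..n}" "1 \<le> n" and xy: "x \<in> {1..n}" "y \<in> {1..n}" "x < y"
    and sub: "rhombus \<theta> p x y \<subseteq> region w"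
    and edges: "path_edge \<theta> id n \<subseteq> rhombus \<theta> p x y" "path_edge \<theta> w n \<subseteq> rhombus \<theta> p x y"
  shows "x = w n \<and> y = n \<and> p = P w n - cis (\<theta> (w n)) - cis (\<theta> n)"
proof -
  note mem = mem_rhombus_iff[OF xy]
  have id: "id permutes {1..n}" by (rule permutes_id)
  have hx: "0 < h x" and hy: "0 < h y" using h_pos xy by auto
  define B where "B = P id n"
  have ImB: "Im B = - H id n" by (simp add: B_def Im_P)
  have edge: "B - Complex (c (u n) * s) (- s) \<in> path_edge \<theta> u n
      \<and> X u (H id n - s) = Re B - c (u n) * s"
    if u: "u permutes {1..n}" and s: "0 \<le> s" "s \<le> h (u n)" for u s
  proof -
    have un: "u n \<in> {1..n}" using permutes_in[OF u] w by auto
    have Hn: "H id n = H u (n - 1) + h (u n)" using H_step[OF w(2), of u] H_total[OF u] by simp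
    have "Re B = Re (P u (n - 1)) + c (u n) * h (u n)"
      using P_step[OF w(2), of u] P_total[OF u] Re_cis_h[OF un] by (simp add: B_def del: cis.sel)
    then have "X u (H id n - s) = Re B - c (u n) * s"
      using X_on_edge[OF u w(2) order_refl, of "h (u n) - s"] s by (simp add: Hn algebra_simps)
    moreover have "- Im (B - Complex (c (u n) * s) (- s)) = H id n - s" by (simp add: ImB)
    moreover have "H u (n - 1) \<le> H id n - s" "H id n - s \<le> H u n"
      using s Hn H_total[OF u] by linarith+
    ultimately show ?thesis
      unfolding path_edge_eq[OF u w(2) order_refl] mem_Collect_eq by simp
  qed
  have "B \<in> rhombus \<theta> p x y"
  proof -
    have "w n \<in> {1..n}" using permutes_in[OF w(1,2)] by simp
    then have "B - Complex (c (w n) * 0) (- 0) \<in> path_edge \<theta> w n"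
      using edge[OF w(1), of 0] h_pos[of "w n"] by auto
    moreover have "Complex (c (w n) * 0) (- 0) = 0" by (simp add: complex_eq_iff)
    ultimately show ?thesis using edges(2) by auto
  qed
  then have B: "Im p - Im B \<le> h x + h y" "G x y (Im p - Im B) \<le> Re B - Re p" "Re B - Re p \<le> G y x (Im p - Im B)"
    unfolding mem by auto
  have bot: "G x y (h x + h y) = c x * h x + c y * h y" "G y x (h x + h y) = c x * h x + c y * h y"
    using hx hy by (auto simp: G_def clip_def)
  define z where "z = p + Complex (c x * h x + c y * h y) (- (h x + h y))"
  have "z \<in> rhombus \<theta> p x y" unfolding mem z_def using bot hx hy by simp
  then have "z \<in> region w" using sub by blast
  then have "- Im z \<le> H id n" by (simp add: region_def)
  then have \<sigma>: "Im p - Im B = h x + h y" using B(1) ImB by (simp add: z_def)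
  then have Re: "Re B - Re p = c x * h x + c y * h y" using B bot by simp
  \<comment> \<open>Small enough that height \<open>s\<close> above \<open>B\<close> still meets the
    lowest sides of the tile and the last edges of both boundaries.\<close>
  define s where "s = min (min (h x) (h y)) (min (h n) (h (w n)))"
  have wn: "w n \<in> {1..n}" "n \<in> {1..n}" using permutes_in[OF w(1)] w by auto
  have s: "0 < s" "s \<le> h x" "s \<le> h y" "s \<le> h n" "s \<le> h (w n)"
    using hx hy h_pos[OF wn(1)] h_pos[OF wn(2)] by (auto simp: s_def)
  have G: "G y x (h x + h y - s) = c x * h x + c y * h y - c x * s"
    "G x y (h x + h y - s) = c x * h x + c y * h y - c y * s"
    using G_above_bottom[OF xy(1,2), of s] G_above_bottom[OF xy(2,1), of s] s by (simp_all add: add.commute)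
  have depth: "Im p - Im (B - Complex r (- s)) = h x + h y - s" for r using \<sigma> by simp
  have pos: "Re (B - Complex r (- s)) - Re p = c x * h x + c y * h y - r" for r using Re by simp
  have inR: "B - Complex r (- s) \<in> rhombus \<theta> p x y \<longleftrightarrow> c x * s \<le> r \<and> r \<le> c y * s" for r
    unfolding mem depth pos G using s hx hy by auto
  have "c n * s \<le> c y * s" using edge[OF id, of s] edges(1) inR[of "c n * s"] s by auto
  then have "c n \<le> c y" using s by simp
  then have "y = n" using c_less[of y n] xy(2) wn(2) by (cases "y = n") auto
  have "c x * s \<le> c (w n) * s" using edge[OF w(1), of s] edges(2) inR[of "c (w n) * s"] s by auto
  moreover have "c (w n) * s \<le> c x * s"
  proof -
    have "c x * s \<le> c y * s" using c_less[OF xy] s by simp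
    then have "B - Complex (c x * s) (- s) \<in> region w" using inR[of "c x * s"] sub by blast
    moreover have "- Im (B - Complex (c x * s) (- s)) = H id n - s" by (simp add: ImB)
    ultimately have "Re (B - Complex (c x * s) (- s)) \<le> X w (H id n - s)" by (simp only: region_depthD)
    then show ?thesis using edge[OF w(1), of s] s by simp
  qed
  ultimately have "c x = c (w n)" using s by simp
  then have "x = w n" using c_eq_iff[OF xy(1) wn(1)] by simp
  moreover have "p = B - cis (\<theta> x) - cis (\<theta> y)"
    using Re \<sigma> Re_cis_h[OF xy(1)] Re_cis_h[OF xy(2)] Im_cis_h[of x] Im_cis_h[of y]
    by (simp add: complex_eq_iff del: cis.sel)
  ultimately show ?thesis using \<open>y = n\<close> P_total[OF w(1)] by (simp add: B_def)
qed

lemma bottom_perimeter_tile_eq: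
  assumes w: "w permutes {1..n}" "1 \<le> n" and T: "tiling w T" "R \<in> T"
    and R: "has_label_set \<theta> n R L" "bottom_perimeter_tile \<theta> n w R"
  shows "L = {w n, n} \<and> R = rhombus \<theta> (P w n - cis (\<theta> (w n)) - cis (\<theta> n)) (w n) n"
proof -
  obtain i j p where ij: "i \<in> {1..n}" "j \<in> {1..n}" "i \<noteq> j" "L = {i, j}" "R = rhombus \<theta> p i j"
    using R(1) unfolding has_label_set_def by blast
  have edges: "path_edge \<theta> id n \<subseteq> R" "path_edge \<theta> w n \<subseteq> R"
    using R(2) unfolding bottom_perimeter_tile_def edge_of_def by (auto dest: face_of_imp_subset)
  have sub: "R \<subseteq> region w" using tiling_subset[OF T] .
  show ?thesis
  proof (cases "i < j")
    case True
    then show ?thesis using bottom_tile_labels[OF w ij(1,2) True] sub edges ij by auto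
  next
    case False
    then have ji: "j < i" using ij by simp
    have "R = rhombus \<theta> p j i" using ij rhombus_commute by simp
    then show ?thesis using bottom_tile_labels[OF w ij(2,1) ji] sub edges ij by auto
  qed
qed

text \<open>Induction on the number of tiles, with the last hypothesis as invariant.
  \<open>u n \<noteq> n\<close> keeps \<open>u\<close> different from \<open>id\<close>, so some
  tile is removable; unless it involves the last position, its removal changes neither the last
  entry nor the bottom vertex.\<close>

lemma bottom_tile_in_tiling:
  assumes "u permutes {1..n}" "1 \<le> n" "tiling u T" "u n \<noteq> n"
    and "\<And>p q. u p = n \<Longrightarrow> p < q \<Longrightarrow> q \<le> n \<Longrightarrow> u q \<le> u n"
  shows "rhombus \<theta> (P u n - cis (\<theta> (u n)) - cis (\<theta> n)) (u n) n \<in> T"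
  using assms
proof (induction "card T" arbitrary: T u rule: less_induct)
  case less
  note u = less.prems(1) and T = less.prems(3)
  have "u \<noteq> id" using less.prems(4) by auto
  then obtain k where k: "1 \<le> k" "k < n" "u (Suc k) < u k"
    and R: "rhombus \<theta> (P u (k - 1)) (u (Suc k)) (u k) \<in> T" (is "?R \<in> T")
    using removable_tile[OF u T] by blast
  show ?case
  proof (cases "Suc k = n")
    case True
    obtain p where p: "u p = n" using permutes_surj[OF u] by (metis surjD)
    then have "p \<in> {1..n}" using permutes_in_image[OF u, of p] less.prems(2) by simp
    moreover have "p \<noteq> n" using less.prems(4) p by blast
    ultimately have "p \<le> k" using True by auto
    \<comment> \<open>If \<open>n\<close> stood before position \<open>k\<close>, the entry at
      \<open>k\<close> would be at most the last one and there would be no descent. So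
      \<open>n\<close> is the value exchanged with the last entry.\<close>
    moreover have "\<not> p < k" using less.prems(5)[OF p, of k] k True by auto
    ultimately have "u k = n" using p by simp
    moreover have "P u (k - 1) = P u n - cis (\<theta> (u n)) - cis (\<theta> (u k))"
      using P_step[OF k(1), of u] P_Suc[of u k] True by simp
    ultimately show ?thesis using R True by simp
  next
    case False
    let ?u = "swap u k"
    have un: "?u n = u n" "P ?u n = P u n" using k False P_swap[of k n u] by auto
    have "card (T - {?R}) < card T" using R tiling_finite[OF T] by (rule card_Diff1_less[rotated])
    then have "rhombus \<theta> (P ?u n - cis (\<theta> (?u n)) - cis (\<theta> n)) (?u n) n \<in> T - {?R}"
    proof (rule less.hyps)
      show "?u permutes {1..n}" using swap_permutes[OF u k(1,2)] .
      show "tiling ?u (T - {?R})" using tiling_remove_tile[OF u T k R] .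
      show "?u n \<noteq> n" using un less.prems(4) by simp
      fix p q assume p: "?u p = n" "p < q" "q \<le> n"
      have uk: "u k \<in> {1..n}" using permutes_in[OF u k(1)] k by simp
      show "?u q \<le> ?u n"
      proof (cases "Transposition.transpose k (Suc k) p < Transposition.transpose k (Suc k) q")
        case True
        have "Transposition.transpose k (Suc k) q \<le> n"
          using p k by (auto simp: Transposition.transpose_def)
        then show ?thesis using less.prems(5)[OF _ True] p un by simp
      next
        \<comment> \<open>Only positions \<open>k\<close> and \<open>k + 1\<close> change their
          order, and \<open>n\<close> at position \<open>k\<close> after the exchange would mean
          \<open>u (Suc k) = n\<close>, impossible at a descent.\<close>
        case False
        then have "p = k" "q = Suc k" using p by (auto simp: Transposition.transpose_def split: if_splits)
        then show ?thesis using p k uk by simp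
      qed
    qed (use less.prems in simp)
    then show ?thesis using un by simp
  qed
qed

end

section \<open>Combinatorics of the last entry\<close>

lemma fully_supported_last:
  assumes "w permutes {1..n}" "fully_supported n w" "2 \<le> n"
  shows "w n \<noteq> n"
proof
  assume "w n = n"
  have "{1..n} = insert n {1..n - 1}" using assms(3) by auto
  then have "w ` {1..n - 1} = w ` ({1..n} - {n})" by auto
  also have "\<dots> = w ` {1..n} - w ` {n}"
    using permutes_inj[OF assms(1)] by (rule image_set_diff)
  also have "\<dots> = {1..n - 1}"
    using permutes_image[OF assms(1)] \<open>w n = n\<close> assms(3) by auto
  finally show False using assms(2,3) unfolding fully_supported_def by force
qed

text \<open>All three conditions of the theorem say that no value after \<open>n\<close> exceeds the last one.\<close>

lemma together_in_321_last_iff: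
  assumes w: "w permutes {1..n}" "w n \<noteq> n" "1 \<le> n"
  shows "together_in_321 n w (w n) n \<longleftrightarrow> (\<exists>p q. 1 \<le> p \<and> w p = n \<and> p < q \<and> q < n \<and> w n < w q)"
proof
  assume "together_in_321 n w (w n) n"
  then obtain i j l where ijl: "1 \<le> i" "i < j" "j < l" "l \<le> n" "w i > w j" "w j > w l"
    "w n \<in> {w i, w j, w l}" "n \<in> {w i, w j, w l}"
    unfolding together_in_321_def by blast
  have "w i \<le> n" using ijl permutes_in_image[OF w(1), of i] by auto
  \<comment> \<open>The largest value of all can only be the first entry of the pattern, and the
    last position can only be its third.\<close>
  then have "w i = n" using ijl by auto
  moreover have "l = n"
    using ijl permutes_inj[OF w(1)] w(2) calculation by (auto simp: inj_eq)
  ultimately show "\<exists>p q. 1 \<le> p \<and> w p = n \<and> p < q \<and> q < n \<and> w n < w q" using ijl by blast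
next
  assume "\<exists>p q. 1 \<le> p \<and> w p = n \<and> p < q \<and> q < n \<and> w n < w q"
  then obtain p q where pq: "1 \<le> p" "w p = n" "p < q" "q < n" "w n < w q" by blast
  have "w q \<le> n" using pq permutes_in_image[OF w(1), of q] by auto
  moreover have "w q \<noteq> w p" using pq(3) permutes_inj[OF w(1)] by (simp add: inj_eq)
  ultimately show "together_in_321 n w (w n) n"
    unfolding together_in_321_def using pq
    by (intro exI[of _ p] exI[of _ q] exI[of _ n]) auto
qed

lemma first_rl_max_after_last_iff:
  assumes w: "w permutes {1..n}" "w n \<noteq> n" "1 \<le> n"
  shows "first_rl_max_after_last n w n \<longleftrightarrow>
    \<not> (\<exists>p q. 1 \<le> p \<and> w p = n \<and> p < q \<and> q < n \<and> w n < w q)"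
proof -
  obtain p where p: "w p = n" using permutes_surj[OF w(1)] by (metis surjD)
  have only: "p' = p" if "w p' = n" for p' using that p permutes_inj[OF w(1)] by (metis injD)
  have "p \<in> {1..n}" using permutes_in_image[OF w(1), of p] p w(3) by simp
  moreover have "p \<noteq> n" using w(2) p by blast
  ultimately have p_in: "1 \<le> p" "p < n" by auto
  have top: "rl_max_at n w p"
    unfolding rl_max_at_def
  proof (intro conjI allI impI)
    fix j assume j: "p < j \<and> j \<le> n"
    then have "w j \<le> n" using permutes_in_image[OF w(1), of j] by auto
    moreover have "w j \<noteq> n" using j only by blast
    ultimately show "w j < w p" using p by simp
  qed (use p_in in auto)
  have "(\<forall>j. p < j \<and> j < n \<longrightarrow> \<not> rl_max_at n w j) \<longleftrightarrow> \<not> (\<exists>q. p < q \<and> q < n \<and> w n < w q)"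
  proof
    assume none: "\<forall>j. p < j \<and> j < n \<longrightarrow> \<not> rl_max_at n w j"
    show "\<not> (\<exists>q. p < q \<and> q < n \<and> w n < w q)"
    proof
      assume "\<exists>q. p < q \<and> q < n \<and> w n < w q"
      then have ne: "{q. p < q \<and> q < n \<and> w n < w q} \<noteq> {}" (is "?S \<noteq> {}") by blast
      have fin: "finite ?S" by (rule finite_subset[of _ "{..n}"]) auto
      \<comment> \<open>The last position with such a value is a right-to-left maximum, since
        everything after it is at most \<open>w n\<close>.\<close>
      define q where "q = Max ?S"
      have q: "p < q" "q < n" "w n < w q" using Max_in[OF fin ne] by (auto simp: q_def)
      have "rl_max_at n w q"
        unfolding rl_max_at_def
      proof (intro conjI allI impI)
        fix j assume j: "q < j \<and> j \<le> n"
        have "j \<notin> ?S"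
        proof
          assume "j \<in> ?S"
          then have "j \<le> q" unfolding q_def by (rule Max_ge[OF fin])
          then show False using j by simp
        qed
        then have "w j \<le> w n" using j q by (cases "j = n") auto
        then show "w j < w q" using q by simp
      qed (use p_in q in auto)
      then show False using none q by blast
    qed
  next
    assume "\<not> (\<exists>q. p < q \<and> q < n \<and> w n < w q)"
    then show "\<forall>j. p < j \<and> j < n \<longrightarrow> \<not> rl_max_at n w j"
      unfolding rl_max_at_def by (metis order_refl)
  qed
  moreover have "first_rl_max_after_last n w n \<longleftrightarrow> (\<forall>j. p < j \<and> j < n \<longrightarrow> \<not> rl_max_at n w j)"
    unfolding first_rl_max_after_last_def using top p p_in only by metis
  ultimately show ?thesis using only p p_in by metis
qed

context elnitsky
begin

section \<open>When the bottom tile is forced\<close>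

lemma rhombic_tiling_with_bottom_tile:
  assumes w: "w permutes {1..n}" "2 \<le> n" "fully_supported n w"
    and pq: "w p = n" "p < q" "q < n" "w n < w q"
  obtains T b where "T \<in> rhombic_tilings \<theta> n w" "b \<in> {1..n}" "w n < b" "b < n"
    "rhombus \<theta> (P w n - cis (\<theta> (w n)) - cis (\<theta> b)) (w n) b \<in> T"
proof -
  have n1: "1 \<le> n" using w by simp
  have "1 \<le> p" using permutes_in_image[OF w(1), of p] pq(1) n1 by simp
  let ?S = "{q. p < q \<and> q < n \<and> w n < w q}"
  have ne: "?S \<noteq> {}" using pq by blast
  have fin: "finite ?S" by (rule finite_subset[of _ "{..n}"]) auto
  \<comment> \<open>The rightmost such position leaves only entries smaller than \<open>w n\<close>
    between it and the end; since it lies after \<open>p\<close>, its value is not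
    \<open>n\<close>.\<close>
  define r where "r = Max ?S"
  have r: "p < r" "r < n" "w n < w r" using Max_in[OF fin ne] by (auto simp: r_def)
  have later: "w i < w n" if "r < i" "i < n" for i
  proof -
    have "i \<notin> ?S"
    proof
      assume "i \<in> ?S"
      then have "i \<le> r" unfolding r_def by (rule Max_ge[OF fin])
      then show False using that by simp
    qed
    moreover have "w i \<noteq> w n" using permutes_inj[OF w(1)] that by (simp add: inj_eq)
    ultimately show ?thesis using that r by auto
  qed
  have "w r \<in> {1..n}" using permutes_in[OF w(1), of r] r by auto
  moreover have "w r \<noteq> w p" using permutes_inj[OF w(1)] r by (simp add: inj_eq)
  ultimately have b: "w r \<in> {1..n}" "w r < n" using pq(1) by auto
  obtain T where "fitted_tiling w T"
    "rhombus \<theta> (P w n - cis (\<theta> (w n)) - cis (\<theta> (w r))) (w n) (w r) \<in> T"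
    using fitted_tiling_with_bottom_tile[OF w(1) _ r(2,3) later] r \<open>1 \<le> p\<close> by auto
  moreover from this have "T \<in> rhombic_tilings \<theta> n w"
    using rhombic_tiling_of_tiling[OF w] unfolding fitted_tiling_def by blast
  ultimately show ?thesis using that b r(3) by blast
qed

text \<open>Both tiles have the bottom vertex \<open>B\<close> and share the side with label
  \<open>a\<close> there, so just above \<open>B\<close> both contain the sector between the
  directions \<open>a\<close> and \<open>b\<close>. Hence they cannot belong to the same
  tiling.\<close>

lemma bottom_rhombi_overlap:
  assumes ij: "a \<in> {1..n}" "b \<in> {1..n}" "d \<in> {1..n}" "a < b" "b < d"
  obtains z where "z \<in> interior (rhombus \<theta> (B - cis (\<theta> a) - cis (\<theta> b)) a b)"
    "z \<in> interior (rhombus \<theta> (B - cis (\<theta> a) - cis (\<theta> d)) a d)"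
proof -
  have ad: "a < d" using ij by simp
  define s where "s = min (h a) (min (h b) (h d))"
  have s: "0 < s" "s \<le> h a" "s \<le> h b" "s \<le> h d"
    using h_pos[OF ij(1)] h_pos[OF ij(2)] h_pos[OF ij(3)] by (auto simp: s_def)
  \<comment> \<open>Halfway between the slopes \<open>c a\<close> and \<open>c b\<close>, at height
    \<open>s\<close> above \<open>B\<close>.\<close>
  define r where "r = (c a + c b) / 2 * s"
  have "c a < c b" "c b < c d" using c_less ij by auto
  then have "c a * s < c b * s" "c b * s < c d * s" using s by auto
  moreover have "r = (c a * s + c b * s) / 2" by (simp add: r_def algebra_simps)
  ultimately have r: "c a * s < r" "r < c b * s" "r < c d * s" by auto
  define z where "z = B - Complex r (- s)"
  have "z \<in> interior (rhombus \<theta> (B - cis (\<theta> a) - cis (\<theta> e)) a e)"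
    if e: "e \<in> {1..n}" "a < e" "s \<le> h e" "r < c e * s" for e
  proof -
    have d: "Im (B - cis (\<theta> a) - cis (\<theta> e)) - Im z = h a + h e - s"
      "Re z - Re (B - cis (\<theta> a) - cis (\<theta> e)) = c a * h a + c e * h e - r"
      using Re_cis_h[OF ij(1)] Re_cis_h[OF e(1)] by (simp_all add: z_def Im_cis_h del: cis.sel)
    have "G e a (h a + h e - s) = c a * h a + c e * h e - c a * s"
      "G a e (h a + h e - s) = c a * h a + c e * h e - c e * s"
      using G_above_bottom[OF ij(1) e(1), of s] G_above_bottom[OF e(1) ij(1), of s] s e by (simp_all add: add.commute)
    then have "0 < h a + h e - s \<and> h a + h e - s < h a + h e \<and>
        G a e (h a + h e - s) < c a * h a + c e * h e - r \<and>
        c a * h a + c e * h e - r < G e a (h a + h e - s)"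
      using s e r h_pos[OF e(1)] by auto
    then show ?thesis
      using interior_rhombus[OF ij(1) e(1,2), of "B - cis (\<theta> a) - cis (\<theta> e)" z, unfolded d] by blast
  qed
  then show ?thesis using that ij ad s r by blast
qed

text \<open>Being forced is a statement about all tilings; it determines the labels because at least
  one tiling exists.\<close>

lemma forced_bottom_perimeter_tile_labels:
  assumes w: "w permutes {1..n}" "2 \<le> n" "fully_supported n w"
    and forced: "forced_bottom_perimeter_tile \<theta> n w L"
  shows "L = {w n, n}"
proof -
  have n1: "1 \<le> n" using w by simp
  obtain T where T: "tiling w T" using fitted_tiling_exists[OF w(1)] unfolding fitted_tiling_def by blast
  then have "T \<in> rhombic_tilings \<theta> n w" by (rule rhombic_tiling_of_tiling[OF w])
  then obtain R where "R \<in> T" "has_label_set \<theta> n R L" "bottom_perimeter_tile \<theta> n w R"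
    using forced unfolding forced_bottom_perimeter_tile_def by blast
  then show ?thesis using bottom_perimeter_tile_eq[OF w(1) n1 T] by blast
qed

text \<open>Some tiling has a tile at the bottom vertex with labels \<open>w n\<close> and
  \<open>b < n\<close>. A bottom-perimeter tile in it would have the labels \<open>w n\<close> and
  \<open>n\<close> and overlap the former, so the two would be equal.\<close>

lemma not_forced_bottom_perimeter_tile:
  assumes w: "w permutes {1..n}" "2 \<le> n" "fully_supported n w"
    and pq: "w p = n" "p < q" "q < n" "w n < w q"
  shows "\<not> forced_bottom_perimeter_tile \<theta> n w L"
proof
  assume forced: "forced_bottom_perimeter_tile \<theta> n w L"
  have n1: "1 \<le> n" using w by simp
  have wn: "w n \<in> {1..n}" using permutes_in[OF w(1)] n1 by simp
  obtain T b where T: "T \<in> rhombic_tilings \<theta> n w" and b: "b \<in> {1..n}" "w n < b" "b < n"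
    and R0: "rhombus \<theta> (P w n - cis (\<theta> (w n)) - cis (\<theta> b)) (w n) b \<in> T" (is "?R0 \<in> T")
    using rhombic_tiling_with_bottom_tile[OF w pq] .
  have til: "tiling w T" using tiling_of_rhombic_tiling[OF w(1) n1 T] .
  obtain R where R: "R \<in> T" "has_label_set \<theta> n R L" "bottom_perimeter_tile \<theta> n w R"
    using T forced unfolding forced_bottom_perimeter_tile_def by blast
  have sub: "path_edge \<theta> id n \<subseteq> R" "path_edge \<theta> w n \<subseteq> R"
    using R(3) unfolding bottom_perimeter_tile_def edge_of_def by (auto dest: face_of_imp_subset)
  have R_eq: "R = rhombus \<theta> (P w n - cis (\<theta> (w n)) - cis (\<theta> n)) (w n) n"
    using bottom_perimeter_tile_eq[OF w(1) n1 til R] by blast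
  have "n \<in> {1..n}" using n1 by simp
  from bottom_rhombi_overlap[OF wn b(1) this b(2,3), of "P w n"]
  obtain z where "z \<in> interior ?R0" "z \<in> interior R" unfolding R_eq .
  then have "?R0 = R" using overlapping_tiles_eq[OF tiling_pairwise[OF til] R0 R(1)] by blast
  then have "b = n"
    using bottom_tile_labels[OF w(1) n1 wn b(1,2) tiling_subset[OF til R0]] sub by blast
  then show False using b(3) by simp
qed

lemma edge_of_rhombus:
  assumes "closed_segment a (a + cis (\<theta> i)) face_of S"
  shows "closed_segment a (a + cis (\<theta> i)) edge_of S"
proof -
  have "a \<noteq> a + cis (\<theta> i)" by simp
  then have "aff_dim (closed_segment a (a + cis (\<theta> i))) = 1"
    by (simp only: segment_convex_hull aff_dim_convex_hull aff_dim_2) simp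
  then show ?thesis using assms unfolding edge_of_def by simp
qed

lemma forced_bottom_perimeter_tile_last:
  assumes w: "w permutes {1..n}" "2 \<le> n" "fully_supported n w"
    and none: "\<And>p q. w p = n \<Longrightarrow> p < q \<Longrightarrow> q < n \<Longrightarrow> w q \<le> w n"
  shows "forced_bottom_perimeter_tile \<theta> n w {w n, n}"
  unfolding forced_bottom_perimeter_tile_def
proof
  fix T assume "T \<in> rhombic_tilings \<theta> n w"
  have n1: "1 \<le> n" using w by simp
  have lab: "w n \<in> {1..n}" "n \<in> {1..n}" using permutes_in[OF w(1)] n1 by auto
  have ne: "w n \<noteq> n" using fully_supported_last[OF w(1,3,2)] .
  have T: "tiling w T" using tiling_of_rhombic_tiling[OF w(1) n1 \<open>T \<in> _\<close>] .
  define p where "p = P w n - cis (\<theta> (w n)) - cis (\<theta> n)"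
  define R where "R = rhombus \<theta> p (w n) n"
  have "R \<in> T"
    unfolding R_def p_def
  proof (rule bottom_tile_in_tiling[OF w(1) n1 T ne])
    show "w q \<le> w n" if "w p = n" "p < q" "q \<le> n" for p q
      using none[of p q] that by (cases "q = n") auto
  qed
  moreover have "has_label_set \<theta> n R {w n, n}"
    unfolding has_label_set_def R_def using lab ne by blast
  moreover have "bottom_perimeter_tile \<theta> n w R"
  proof -
    \<comment> \<open>Seen from the top \<open>p\<close> of the tile, both last edges are lower
      sides of the rhombus. Thus the second part of \<open>rhombus_sides\<close> covers both, with
      the labels exchanged for one of them.\<close>
    have "P w n = P w (n - 1) + cis (\<theta> (w n))" "P w n = P id (n - 1) + cis (\<theta> n)" "P id n = P w n"
      using P_step[OF n1, of w] P_step[OF n1, of id] P_total[OF w(1)] by simp_all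
    then have "P w (n - 1) = p + cis (\<theta> n)" "P w n = p + cis (\<theta> n) + cis (\<theta> (w n))"
      "P id (n - 1) = p + cis (\<theta> (w n))" "P id n = p + cis (\<theta> (w n)) + cis (\<theta> n)"
      unfolding p_def by (simp_all add: algebra_simps)
    then have "path_edge \<theta> w n = closed_segment (p + cis (\<theta> n)) (p + cis (\<theta> n) + cis (\<theta> (w n)))"
      "path_edge \<theta> id n = closed_segment (p + cis (\<theta> (w n))) (p + cis (\<theta> (w n)) + cis (\<theta> n))"
      by (simp_all only: path_edge_def)
    then show ?thesis
      unfolding bottom_perimeter_tile_def R_def
      using edge_of_rhombus rhombus_sides(2)[OF lab ne, of p]
        rhombus_sides(2)[OF lab(2,1) ne[symmetric], of p] rhombus_commute[of p n "w n"] by simp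
  qed
  ultimately show "\<exists>R\<in>T. has_label_set \<theta> n R {w n, n} \<and> bottom_perimeter_tile \<theta> n w R" by blast
qed

end

theorem corollary4p12:
  fixes n :: nat and w :: "nat \<Rightarrow> nat" and \<theta> :: "nat \<Rightarrow> real"
  assumes "n \<ge> 2"
    and "w permutes {1..n}"
    and "fully_supported n w"
    and "admissible_angles n \<theta>"
  shows "((\<exists>x y. forced_bottom_perimeter_tile \<theta> n w {x, y}) \<longleftrightarrow> \<not> together_in_321 n w (w n) n) \<and>
         (\<not> together_in_321 n w (w n) n \<longleftrightarrow> first_rl_max_after_last n w n) \<and>
         (\<forall>x y. forced_bottom_perimeter_tile \<theta> n w {x, y} \<longrightarrow> {x, y} = {n, w n})"
proof -
  interpret elnitsky n \<theta> by unfold_locales (rule assms(4))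
  note w = assms(2,1,3)
  have ne: "w n \<noteq> n" using fully_supported_last[OF assms(2,3,1)] .
  have n1: "1 \<le> n" using assms(1) by simp
  define bad where "bad \<longleftrightarrow> (\<exists>p q. 1 \<le> p \<and> w p = n \<and> p < q \<and> q < n \<and> w n < w q)"
  have together: "together_in_321 n w (w n) n \<longleftrightarrow> bad"
    and first: "first_rl_max_after_last n w n \<longleftrightarrow> \<not> bad"
    unfolding bad_def
    using together_in_321_last_iff[OF assms(2) ne n1] first_rl_max_after_last_iff[OF assms(2) ne n1]
    by blast+
  have "(\<exists>x y. forced_bottom_perimeter_tile \<theta> n w {x, y}) \<longleftrightarrow> \<not> bad"
  proof
    assume "\<exists>x y. forced_bottom_perimeter_tile \<theta> n w {x, y}"
    then show "\<not> bad" unfolding bad_def using not_forced_bottom_perimeter_tile[OF w] by blast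
  next
    assume "\<not> bad"
    have "w q \<le> w n" if q: "w p = n" "p < q" "q < n" for p q
    proof -
      have "1 \<le> p" using permutes_in_image[OF assms(2), of p] q(1) n1 by simp
      then have "\<not> w n < w q" using \<open>\<not> bad\<close> q unfolding bad_def by blast
      then show ?thesis by simp
    qed
    then show "\<exists>x y. forced_bottom_perimeter_tile \<theta> n w {x, y}" using forced_bottom_perimeter_tile_last[OF w] by blast
  qed
  moreover have "\<forall>x y. forced_bottom_perimeter_tile \<theta> n w {x, y} \<longrightarrow> {x, y} = {n, w n}"
    using forced_bottom_perimeter_tile_labels[OF w] by (metis insert_commute)
  ultimately show ?thesis using together first by blast
qed

end
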